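(* Fix integers $\ell\ge 1$ and $C\ge 0$ (independent of $n$). For each $n\ge 1$, let $N=N_n$ be a subgraph of the complete graph $K_{2n}$ and let $D_1,\dots,D_\ell$ (depending on $n$) be pairwise edge-disjoint subgraphs of $K_{2n}-N$ such that $\Delta(N)\le C$ and $\Delta(D_m)\le C$ for all $m\in[\ell]$. Let $R$ be a uniformly random perfect matching of $K_{2n}-N$. Let $\mathbf X=(X_m)_{m=1}^\ell$ with $X_m=|E(R\cap D_m)|$, and let $\mathbf Y=(Y_m)_{m=1}^\ell$ where the $Y_m$ are independent and $Y_m\sim\mathrm{Poisson}(|E(D_m)|/(2n))$. Then \[\lim_{n\to\infty} d_{TV}(\mathbf X,\mathbf Y)=0.\]
   Context: For random vectors $\mathbf X,\mathbf Y$ taking values in $\mathbb N^\ell$ (with $\mathbb N=\{0,1,2,\dots\}$), the paper defines $d_{TV}(\mathbf X,\mathbf Y)=\sum_{\mathbf k\in\mathbb N^\ell}|\mathbb P(\mathbf X=\mathbf k)-\mathbb P(\mathbf Y=\mathbf k)|$ (no factor $1/2$). $\Delta(\cdot)$ denotes maximum degree. $E(R\cap D_m)$ is the set of edges lying in both $R$ and $D_m$. *)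

theory Defs
  imports "HOL-Probability.Probability"
begin

section \<open>Finite simple graphs\<close>

record 'a graph =
  verts :: "'a set"
  edges :: "'a set set"

definition simple_graph :: "'a graph \<Rightarrow> bool" where
  "simple_graph G \<longleftrightarrow> finite (verts G) \<and> (\<forall>e\<in>edges G. e \<subseteq> verts G \<and> card e = 2)"

definition subgraph :: "'a graph \<Rightarrow> 'a graph \<Rightarrow> bool" where
  "subgraph H G \<longleftrightarrow> simple_graph H \<and> verts H \<subseteq> verts G \<and> edges H \<subseteq> edges G"

definition complete_graph :: "nat \<Rightarrow> nat graph" where
  "complete_graph k = \<lparr>verts = {1..k}, edges = {e. e \<subseteq> {1..k} \<and> card e = 2}\<rparr>"

text \<open>The graph \<open>G - H\<close>: edges are deleted, vertices are kept.\<close>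

definition delete_edges :: "'a graph \<Rightarrow> 'a graph \<Rightarrow> 'a graph" where
  "delete_edges G H = \<lparr>verts = verts G, edges = edges G - edges H\<rparr>"

definition graph_inter :: "'a graph \<Rightarrow> 'a graph \<Rightarrow> 'a graph" where
  "graph_inter G H = \<lparr>verts = verts G \<inter> verts H, edges = edges G \<inter> edges H\<rparr>"

definition edge_disjoint :: "'a graph \<Rightarrow> 'a graph \<Rightarrow> bool" where
  "edge_disjoint G H \<longleftrightarrow> edges G \<inter> edges H = {}"

definition degree :: "'a graph \<Rightarrow> 'a \<Rightarrow> nat" where
  "degree G v = card {e \<in> edges G. v \<in> e}"

text \<open>The inserted \<open>0\<close> only matters for the graph without vertices.\<close>

definition max_degree :: "'a graph \<Rightarrow> nat" where
  "max_degree G = Max (insert 0 (degree G ` verts G))"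

text \<open>A perfect matching is a spanning 1-regular subgraph.\<close>

definition perfect_matching :: "'a graph \<Rightarrow> 'a graph \<Rightarrow> bool" where
  "perfect_matching M G \<longleftrightarrow>
     subgraph M G \<and> verts M = verts G \<and> (\<forall>v\<in>verts G. degree M v = 1)"

text \<open>Only meaningful when \<open>G\<close> is finite and has a perfect matching; otherwise
  \<^const>\<open>pmf_of_set\<close> is an unspecified distribution.\<close>

definition random_perfect_matching :: "'a graph \<Rightarrow> 'a graph pmf" where
  "random_perfect_matching G = pmf_of_set {M. perfect_matching M G}"


section \<open>Random vectors of natural numbers\<close>

text \<open>Vectors in \<open>\<nat>\<^sup>l\<close> are the functions on \<open>{1..l}\<close> that are
  \<^const>\<open>undefined\<close> elsewhere, so that each vector has exactly one representation.\<close>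

definition nat_vectors :: "nat \<Rightarrow> (nat \<Rightarrow> nat) set" where
  "nat_vectors l = {1..l} \<rightarrow>\<^sub>E UNIV"

text \<open>Random vectors are represented by their laws. There is no factor \<open>1/2\<close>.\<close>

definition d_TV :: "nat \<Rightarrow> (nat \<Rightarrow> nat) pmf \<Rightarrow> (nat \<Rightarrow> nat) pmf \<Rightarrow> real" where
  "d_TV l X Y = (\<Sum>\<^sub>\<infinity>k\<in>nat_vectors l. \<bar>pmf X k - pmf Y k\<bar>)"

text \<open>\<^const>\<open>infsum\<close> is \<open>0\<close> for families that are not summable; that case does not arise.\<close>

lemma d_TV_summable: "(\<lambda>k. \<bar>pmf X k - pmf Y k\<bar>) summable_on A"
proof -
  have s: "pmf p summable_on A" for p :: "'a pmf"
    using abs_summable_equivalent abs_summable_summable pmf_abs_summable by blast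
  show ?thesis
    by (rule summable_on_comparison_test[OF summable_on_add[OF s[of X] s[of Y]]])
      (auto simp: abs_if intro: order_trans[OF _ add_nonneg_nonneg])
qed

text \<open>\<^const>\<open>poisson_pmf\<close> is unspecified at rate \<open>0\<close>, where the Poisson
  distribution is the point mass at \<open>0\<close>.\<close>

definition poisson :: "real \<Rightarrow> nat pmf" where
  "poisson r = (if r = 0 then return_pmf 0 else poisson_pmf r)"

definition edge_count_vector :: "nat \<Rightarrow> (nat \<Rightarrow> 'a graph) \<Rightarrow> 'a graph \<Rightarrow> nat \<Rightarrow> nat" where
  "edge_count_vector l D R = (\<lambda>m\<in>{1..l}. card (edges (graph_inter R (D m))))"

definition independent_poisson_vector :: "nat \<Rightarrow> (nat \<Rightarrow> real) \<Rightarrow> (nat \<Rightarrow> nat) pmf" where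
  "independent_poisson_vector l r = Pi_pmf {1..l} undefined (\<lambda>m. poisson (r m))"

end

theory Submission
  imports Defs "HOL-Combinatorics.Transposition"
begin

text \<open>A perfect matching is a fixed-point-free involution \<open>\<sigma>\<close> of the vertex set, and switching two
  matching edges amounts to conjugating \<open>\<sigma>\<close> by a transposition. Double counting the switchings that
  replace a \<open>D m\<close>-edge and an arbitrary edge of a matching by two edges outside all the given graphs
  compares the matchings with count vector \<open>k + e\<^sub>m\<close> to those with count vector \<open>k\<close>, and yields
  \<open>(k\<^sub>m + 1) P(X = k + e\<^sub>m) - \<lambda>\<^sub>m P(X = k) = O(1/n)\<close> for fixed \<open>k\<close>, where \<open>\<lambda>\<^sub>m = |E(D\<^sub>m)| / (2n)\<close>.
  The Poisson vector satisfies this recursion exactly. Hence \<open>P(X = k)\<close> is asymptotically a common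
  multiple of the Poisson weight of \<open>k\<close>, and since both laws are tight (the expected counts are
  bounded), this multiple tends to \<open>1\<close> and the laws merge in total variation.\<close>

section \<open>Poisson limits from ratios of point probabilities\<close>

text \<open>The rates are bounded but need not converge, so there is no fixed limit law to aim at:
  both laws move with n and only their difference can be controlled. The recursion is kept additive
  because a quotient P(X = k + e_m) / P(X = k) may have a vanishing denominator; with bounded rates
  an error tending to 0 survives any fixed number of steps. In the switching counts both sides may
  have order n times the number of matchings, so an exceptional family is harmless if it has on
  average boundedly many members per matching. There are two kinds: matching edges inside the given
  graphs, whose number is fixed by k, and pairs whose partners are adjacent in the given graphs,
  which k does not control. The second kind needs a switching argument of its own, carried out over
  all matchings and not within one level; hence errors are measured against
  \<open>card \<Omega>\<close>.\<close>

lemma pmf_poisson_all: "0 \<le> r \<Longrightarrow> pmf (poisson r) k = r ^ k / fact k * exp (- r)"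
  by (cases k) (auto simp: poisson_def)

text \<open>Taylor's theorem for exp with Lagrange remainder: multiplied by
  \<open>exp (- r)\<close>, the remainder carries the factor \<open>exp (t - r)\<close>, which is at
  most 1. The bound depends on c alone, so the Poisson tails are small uniformly over all rates up
  to c.\<close>

lemma poisson_atMost_ge:
  assumes r: "0 \<le> r" "r \<le> c"
  shows "1 - c ^ Suc K / fact (Suc K) \<le> (\<Sum>k\<le>K. pmf (poisson r) k)"
proof -
  obtain t where t: "\<bar>t\<bar> \<le> \<bar>r\<bar>"
    and exp_r: "exp r = (\<Sum>m<Suc K. r ^ m / fact m) + (exp t / fact (Suc K)) * r ^ Suc K"
    using Maclaurin_exp_le[of r "Suc K"] by blast
  have "(\<Sum>k\<le>K. pmf (poisson r) k) = (\<Sum>m<Suc K. r ^ m / fact m) * exp (- r)"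
    using r by (simp add: pmf_poisson_all sum_distrib_right lessThan_Suc_atMost)
  also have "\<dots> = (exp r - (exp t / fact (Suc K)) * r ^ Suc K) * exp (- r)"
    using exp_r by simp
  also have "\<dots> = 1 - exp (t - r) * (r ^ Suc K / fact (Suc K))"
    by (simp add: algebra_simps exp_diff exp_minus field_simps)
  also have "\<dots> \<ge> 1 - 1 * (c ^ Suc K / fact (Suc K))"
    using t r by (intro diff_left_mono mult_mono divide_right_mono power_mono) auto
  finally show ?thesis
    by simp
qed

definition nat_box :: "nat \<Rightarrow> nat \<Rightarrow> (nat \<Rightarrow> nat) set" where
  "nat_box l K = {1..l} \<rightarrow>\<^sub>E {..K}"

lemma finite_nat_box [simp]: "finite (nat_box l K)"
  by (simp add: nat_box_def finite_PiE)

lemma nat_box_subset: "nat_box l K \<subseteq> nat_vectors l"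
  by (auto simp: nat_box_def nat_vectors_def)

lemma pmf_independent_poisson_vector:
  assumes "k \<in> nat_vectors l"
  shows "pmf (independent_poisson_vector l r) k = (\<Prod>m\<in>{1..l}. pmf (poisson (r m)) (k m))"
  using assms unfolding independent_poisson_vector_def nat_vectors_def
  by (intro pmf_Pi') (auto simp: PiE_def extensional_def)

text \<open>By independence the mass of a box is the product of the coordinate masses;
  \<open>small\<close> keeps the lower bounds nonnegative so that they can be multiplied.\<close>

lemma independent_poisson_vector_box_ge:
  assumes r: "\<And>m. m \<in> {1..l} \<Longrightarrow> 0 \<le> r m \<and> r m \<le> c" and small: "c ^ Suc K / fact (Suc K) \<le> 1"
  shows "(1 - c ^ Suc K / fact (Suc K)) ^ l \<le> (\<Sum>k\<in>nat_box l K. pmf (independent_poisson_vector l r) k)"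
proof -
  have "(1 - c ^ Suc K / fact (Suc K)) ^ l = (\<Prod>m\<in>{1..l}. 1 - c ^ Suc K / fact (Suc K))"
    by simp
  also have "\<dots> \<le> (\<Prod>m\<in>{1..l}. \<Sum>j\<in>{..K}. pmf (poisson (r m)) j)"
    using r small poisson_atMost_ge by (intro prod_mono) (auto simp del: fact_Suc power_Suc)
  also have "\<dots> = (\<Sum>k\<in>nat_box l K. \<Prod>m\<in>{1..l}. pmf (poisson (r m)) (k m))"
    unfolding nat_box_def by (rule prod_sum_PiE) auto
  also have "\<dots> = (\<Sum>k\<in>nat_box l K. pmf (independent_poisson_vector l r) k)"
    using nat_box_subset by (intro sum.cong refl pmf_independent_poisson_vector[symmetric]) auto
  finally show ?thesis .
qed

text \<open>Outside B the absolute difference is at most the sum of the two masses. This reduces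
  convergence in total variation to pointwise convergence on a finite set together with
  tightness.\<close>

lemma d_TV_le_finite:
  assumes B: "finite B"
  shows "d_TV l X Y \<le> (\<Sum>k\<in>B. \<bar>pmf X k - pmf Y k\<bar>) + (1 - (\<Sum>k\<in>B. pmf X k)) + (1 - (\<Sum>k\<in>B. pmf Y k))"
  unfolding d_TV_def
proof (rule infsum_le_finite_sums[OF d_TV_summable])
  fix F :: "(nat \<Rightarrow> nat) set" assume F: "finite F"
  have tail: "(\<Sum>k\<in>F - B. pmf p k) \<le> 1 - (\<Sum>k\<in>B. pmf p k)" for p :: "(nat \<Rightarrow> nat) pmf"
  proof -
    have "(\<Sum>k\<in>F - B. pmf p k) + (\<Sum>k\<in>B. pmf p k) = (\<Sum>k\<in>(F - B) \<union> B. pmf p k)"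
      using F B by (intro sum.union_disjoint[symmetric]) auto
    also have "\<dots> = measure_pmf.prob p ((F - B) \<union> B)"
      using F B by (simp add: measure_measure_pmf_finite)
    also have "\<dots> \<le> 1"
      by (rule measure_pmf.prob_le_1)
    finally show ?thesis
      by simp
  qed
  have "(\<Sum>k\<in>F. \<bar>pmf X k - pmf Y k\<bar>) = (\<Sum>k\<in>F \<inter> B. \<bar>pmf X k - pmf Y k\<bar>) + (\<Sum>k\<in>F - B. \<bar>pmf X k - pmf Y k\<bar>)"
    using F by (rule sum.Int_Diff)
  also have "\<dots> \<le> (\<Sum>k\<in>B. \<bar>pmf X k - pmf Y k\<bar>) + (\<Sum>k\<in>F - B. pmf X k + pmf Y k)"
    using B by (intro add_mono sum_mono2 sum_mono)
      (auto simp: abs_le_iff intro: add_increasing add_increasing2)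
  finally show "(\<Sum>k\<in>F. \<bar>pmf X k - pmf Y k\<bar>)
      \<le> (\<Sum>k\<in>B. \<bar>pmf X k - pmf Y k\<bar>) + (1 - (\<Sum>k\<in>B. pmf X k)) + (1 - (\<Sum>k\<in>B. pmf Y k))"
    using tail[of X] tail[of Y] by (simp add: sum.distrib)
qed

lemma tendsto_zero_mult_bounded:
  fixes f g :: "nat \<Rightarrow> real"
  assumes "f \<longlonglongrightarrow> 0" and "\<And>n. \<bar>g n\<bar> \<le> c"
  shows "(\<lambda>n. g n * f n) \<longlonglongrightarrow> 0"
  by (rule tendsto_0_le[OF assms(1), of _ c])
    (use assms(2) in \<open>auto simp: abs_mult mult.commute[of _ c] intro!: always_eventually mult_right_mono\<close>)

text \<open>Induction on the coordinate sum: lowering one positive coordinate multiplies the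
  inherited error by a factor of at most c, so it still tends to 0. The product is the Poisson
  weight without its exponential factors; the unknown mass at the zero vector stays as the common
  multiple.\<close>

lemma pointwise_poisson_ratio:
  fixes P :: "nat \<Rightarrow> (nat \<Rightarrow> nat) pmf" and r :: "nat \<Rightarrow> nat \<Rightarrow> real"
  assumes r: "\<And>n m. m \<in> {1..l} \<Longrightarrow> 0 \<le> r n m \<and> r n m \<le> c"
    and ratio: "\<And>k m. k \<in> nat_vectors l \<Longrightarrow> m \<in> {1..l} \<Longrightarrow>
      (\<lambda>n. real (k m + 1) * pmf (P n) (k(m := k m + 1)) - r n m * pmf (P n) k) \<longlonglongrightarrow> 0"
    and k: "k \<in> nat_vectors l"
  shows "(\<lambda>n. pmf (P n) k - pmf (P n) (\<lambda>m\<in>{1..l}. 0) * (\<Prod>m\<in>{1..l}. r n m ^ k m / fact (k m))) \<longlonglongrightarrow> 0"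
  using k
proof (induction "\<Sum>m\<in>{1..l}. k m" arbitrary: k)
  case 0
  then have "k = (\<lambda>m\<in>{1..l}. 0)"
    by (auto simp: nat_vectors_def PiE_def extensional_def fun_eq_iff restrict_def)
  then show ?case
    by simp
next
  case (Suc s)
  then obtain m where m: "m \<in> {1..l}" "k m \<noteq> 0"
    by (metis nat.distinct(1) sum.neutral)
  define j where "j = k(m := k m - 1)"
  have k_eq: "k = j(m := j m + 1)"
    using m by (auto simp: j_def)
  have j: "j \<in> nat_vectors l"
    using Suc.prems m by (auto simp: j_def nat_vectors_def PiE_def extensional_def)
  let ?w = "\<lambda>k n. \<Prod>m\<in>{1..l}. r n m ^ k m / fact (k m)"
  let ?p0 = "\<lambda>n. pmf (P n) (\<lambda>m\<in>{1..l}. 0)"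
  have w: "?w k n = r n m / real (j m + 1) * ?w j n" for n
  proof -
    have "(\<Prod>i\<in>{1..l} - {m}. r n i ^ k i / fact (k i)) = (\<Prod>i\<in>{1..l} - {m}. r n i ^ j i / fact (j i))"
      by (rule prod.cong) (auto simp: j_def)
    then show ?thesis
      using m(1) k_eq by (simp add: prod.remove[of _ m])
  qed
  have "(\<Sum>i\<in>{1..l}. k i) = Suc (\<Sum>i\<in>{1..l}. j i)"
  proof -
    have "(\<Sum>i\<in>{1..l} - {m}. k i) = (\<Sum>i\<in>{1..l} - {m}. j i)"
      by (rule sum.cong) (auto simp: j_def)
    then show ?thesis
      using m by (simp add: sum.remove[of _ m] j_def)
  qed
  then have IH: "(\<lambda>n. pmf (P n) j - ?p0 n * ?w j n) \<longlonglongrightarrow> 0"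
    using Suc j by auto
  have "(\<lambda>n. r n m / real (j m + 1) * (pmf (P n) j - ?p0 n * ?w j n)) \<longlonglongrightarrow> 0"
  proof (rule tendsto_zero_mult_bounded[OF IH])
    fix n
    have "r n m / real (j m + 1) \<le> r n m / 1"
      using r[OF m(1), of n] by (intro divide_left_mono) auto
    then show "\<bar>r n m / real (j m + 1)\<bar> \<le> c"
      using r[OF m(1), of n] by simp
  qed
  moreover have "(\<lambda>n. 1 / real (j m + 1) * (real (j m + 1) * pmf (P n) k - r n m * pmf (P n) j)) \<longlonglongrightarrow> 0"
    using ratio[OF j m(1)] unfolding k_eq[symmetric] by (rule tendsto_mult_right_zero)
  ultimately have "(\<lambda>n. 1 / real (j m + 1) * (real (j m + 1) * pmf (P n) k - r n m * pmf (P n) j)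
      + r n m / real (j m + 1) * (pmf (P n) j - ?p0 n * ?w j n)) \<longlonglongrightarrow> 0 + 0"
    by (intro tendsto_add)
  moreover have "1 / real (j m + 1) * (real (j m + 1) * pmf (P n) k - r n m * pmf (P n) j)
      + r n m / real (j m + 1) * (pmf (P n) j - ?p0 n * ?w j n) = pmf (P n) k - ?p0 n * ?w k n" for n
    unfolding w by (simp add: field_simps del: of_nat_add of_nat_Suc)
  ultimately show ?case
    by simp
qed

text \<open>Normalisation determines the common multiple: on a box carrying almost all the mass of
  both laws, the sum of \<open>pmf (P n) k - a n * q n k\<close> tends to 0, which forces
  \<open>a n\<close> to 1.\<close>

lemma d_TV_poisson_limit:
  fixes P :: "nat \<Rightarrow> (nat \<Rightarrow> nat) pmf" and r :: "nat \<Rightarrow> nat \<Rightarrow> real"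
  assumes r: "\<And>n m. m \<in> {1..l} \<Longrightarrow> 0 \<le> r n m \<and> r n m \<le> c"
    and ratio: "\<And>k m. k \<in> nat_vectors l \<Longrightarrow> m \<in> {1..l} \<Longrightarrow>
      (\<lambda>n. real (k m + 1) * pmf (P n) (k(m := k m + 1)) - r n m * pmf (P n) k) \<longlonglongrightarrow> 0"
    and tight: "\<And>\<epsilon>. 0 < \<epsilon> \<Longrightarrow> \<forall>\<^sub>F K in sequentially. \<forall>\<^sub>F n in sequentially. 1 - \<epsilon> \<le> (\<Sum>k\<in>nat_box l K. pmf (P n) k)"
  shows "(\<lambda>n. d_TV l (P n) (independent_poisson_vector l (r n))) \<longlonglongrightarrow> 0"
proof -
  define q where "q n = pmf (independent_poisson_vector l (r n))" for n
  define e where "e n = (\<Prod>m\<in>{1..l}. exp (- r n m))" for n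
  \<comment> \<open>The quotient of the two masses at the zero vector. It is bounded by
    \<open>A\<close>, since the Poisson mass there is at least \<open>exp (- c) ^ l\<close>; the
    bound is what makes \<open>a n\<close> times the Poisson tail small.\<close>
  define a where "a n = pmf (P n) (\<lambda>m\<in>{1..l}. 0) / e n" for n
  define A where "A = 1 / exp (- c) ^ l"
  have e: "exp (- c) ^ l \<le> e n" for n
  proof -
    have "exp (- c) ^ l = (\<Prod>m\<in>{1..l}. exp (- c))"
      by simp
    also have "\<dots> \<le> e n"
      unfolding e_def using r by (intro prod_mono) auto
    finally show ?thesis .
  qed
  have e_pos: "0 < e n" for n
    unfolding e_def by (intro prod_pos) auto
  have a: "0 \<le> a n" "a n \<le> A" for n
    using e[of n] e_pos[of n] by (auto simp: a_def A_def pmf_le_1 intro!: frac_le)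
  have q: "q n k = e n * (\<Prod>m\<in>{1..l}. r n m ^ k m / fact (k m))" if "k \<in> nat_vectors l" for n k
  proof -
    have "q n k = (\<Prod>m\<in>{1..l}. exp (- r n m) * (r n m ^ k m / fact (k m)))"
      unfolding q_def pmf_independent_poisson_vector[OF that]
      using r by (intro prod.cong) (auto simp: pmf_poisson_all)
    then show ?thesis
      by (simp add: e_def prod.distrib del: times_divide_eq_right)
  qed
  have pq: "(\<lambda>n. pmf (P n) k - a n * q n k) \<longlonglongrightarrow> 0" if k: "k \<in> nat_vectors l" for k
  proof -
    have "a n * q n k = pmf (P n) (\<lambda>m\<in>{1..l}. 0) * (\<Prod>m\<in>{1..l}. r n m ^ k m / fact (k m))" for n
      unfolding q[OF k] a_def using e_pos[of n] by simp
    then show ?thesis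
      using pointwise_poisson_ratio[OF r ratio k] by simp
  qed
  have q_box: "\<forall>\<^sub>F K in sequentially. \<forall>n. 1 - \<epsilon> \<le> (\<Sum>k\<in>nat_box l K. q n k)" if "0 < \<epsilon>" for \<epsilon> :: real
  proof -
    have "(\<lambda>K. inverse (fact K) * c ^ K) \<longlonglongrightarrow> 0"
      by (rule summable_LIMSEQ_zero[OF summable_exp])
    then have lim: "(\<lambda>K. c ^ Suc K / fact (Suc K)) \<longlonglongrightarrow> 0"
      unfolding divide_inverse by (subst mult.commute) (rule LIMSEQ_Suc)
    then have "(\<lambda>K. (1 - c ^ Suc K / fact (Suc K)) ^ l) \<longlonglongrightarrow> (1 - 0) ^ l"
      by (intro tendsto_intros)
    then have "\<forall>\<^sub>F K in sequentially. 1 - \<epsilon> < (1 - c ^ Suc K / fact (Suc K)) ^ l"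
      using that by (intro order_tendstoD(1)) auto
    moreover have "\<forall>\<^sub>F K in sequentially. c ^ Suc K / fact (Suc K) < 1"
      using lim by (intro order_tendstoD(2)) auto
    ultimately show ?thesis
    proof eventually_elim
      case (elim K)
      then show ?case
        unfolding q_def using r
        by (intro allI order_trans[OF less_imp_le[OF elim(1)] independent_poisson_vector_box_ge]) auto
    qed
  qed
  have sum_le_1: "(\<Sum>k\<in>nat_box l K. pmf p k) \<le> 1" for K and p :: "(nat \<Rightarrow> nat) pmf"
    using measure_pmf.prob_le_1[of p "nat_box l K"] by (simp add: measure_measure_pmf_finite)
  have a_lim: "a \<longlonglongrightarrow> 1"
  proof (rule LIMSEQ_I)
    fix \<epsilon> :: real assume \<epsilon>: "0 < \<epsilon>"
    have A: "0 < A"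
      by (simp add: A_def)
    \<comment> \<open>\<open>A + 3\<close> leaves room for the three terms in the identity for
      \<open>a n - 1\<close> below, which are at most \<delta>, \<open>A * \<delta>\<close> and
      \<delta> in absolute value.\<close>
    define \<delta> where "\<delta> = \<epsilon> / (A + 3)"
    have \<delta>: "0 < \<delta>" "\<delta> * (A + 3) = \<epsilon>"
      using \<epsilon> A by (auto simp: \<delta>_def)
    obtain K where P_K: "\<forall>\<^sub>F n in sequentially. 1 - \<delta> \<le> (\<Sum>k\<in>nat_box l K. pmf (P n) k)"
      and q_K: "\<forall>n. 1 - \<delta> \<le> (\<Sum>k\<in>nat_box l K. q n k)"
      using eventually_happens'[OF _ eventually_conj[OF tight[OF \<delta>(1)] q_box[OF \<delta>(1)]]] by auto
    have "(\<lambda>n. \<Sum>k\<in>nat_box l K. pmf (P n) k - a n * q n k) \<longlonglongrightarrow> 0"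
      using nat_box_subset by (intro tendsto_null_sum pq) auto
    then have "\<forall>\<^sub>F n in sequentially. \<bar>\<Sum>k\<in>nat_box l K. pmf (P n) k - a n * q n k\<bar> < \<delta>"
      using \<delta>(1) by (auto simp: tendsto_iff dist_real_def)
    with P_K have "\<forall>\<^sub>F n in sequentially. norm (a n - 1) < \<epsilon>"
    proof eventually_elim
      case (elim n)
      let ?p = "\<Sum>k\<in>nat_box l K. pmf (P n) k" and ?q = "\<Sum>k\<in>nat_box l K. q n k"
      have "\<bar>?p - a n * ?q\<bar> < \<delta>"
        using elim(2) by (simp add: sum_subtractf sum_distrib_left)
      moreover have "0 \<le> a n * (1 - ?q)" "a n * (1 - ?q) \<le> A * \<delta>"
        using a[of n] q_K[rule_format, of n] sum_le_1[of "independent_poisson_vector l (r n)" K]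
        by (auto simp: q_def intro!: mult_mono mult_nonneg_nonneg)
      moreover have "a n - 1 = - (?p - a n * ?q) + a n * (1 - ?q) - (1 - ?p)"
        by (simp add: algebra_simps)
      moreover have "A * \<delta> + 3 * \<delta> = \<epsilon>"
        using \<delta>(2) by (simp add: algebra_simps)
      ultimately show ?case
        using elim(1) sum_le_1[of "P n" K] \<delta>(1) by (simp add: abs_if split: if_splits)
    qed
    then show "\<exists>no. \<forall>n\<ge>no. norm (a n - 1) < \<epsilon>"
      by (simp add: eventually_sequentially)
  qed
  have diff: "(\<lambda>n. \<bar>pmf (P n) k - q n k\<bar>) \<longlonglongrightarrow> 0" if k: "k \<in> nat_vectors l" for k
  proof -
    have "(\<lambda>n. q n k * (a n - 1)) \<longlonglongrightarrow> 0"
      using LIM_zero[OF a_lim] by (rule tendsto_zero_mult_bounded[where c = 1]) (simp add: q_def pmf_le_1)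
    then have "(\<lambda>n. \<bar>(pmf (P n) k - a n * q n k) + q n k * (a n - 1)\<bar>) \<longlonglongrightarrow> \<bar>0 + 0\<bar>"
      using pq[OF k] by (intro tendsto_intros)
    then show ?thesis
      by (simp add: algebra_simps)
  qed
  show ?thesis
  proof (rule LIMSEQ_I)
    fix \<epsilon> :: real assume \<epsilon>: "0 < \<epsilon>"
    \<comment> \<open>The box and the two tails contribute at most \<delta> each.\<close>
    define \<delta> where "\<delta> = \<epsilon> / 4"
    have \<delta>: "0 < \<delta>"
      using \<epsilon> by (simp add: \<delta>_def)
    obtain K where P_K: "\<forall>\<^sub>F n in sequentially. 1 - \<delta> \<le> (\<Sum>k\<in>nat_box l K. pmf (P n) k)"
      and q_K: "\<forall>n. 1 - \<delta> \<le> (\<Sum>k\<in>nat_box l K. q n k)"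
      using eventually_happens'[OF _ eventually_conj[OF tight[OF \<delta>] q_box[OF \<delta>]]] by auto
    have "(\<lambda>n. \<Sum>k\<in>nat_box l K. \<bar>pmf (P n) k - q n k\<bar>) \<longlonglongrightarrow> 0"
      using nat_box_subset by (intro tendsto_null_sum diff) auto
    then have "\<forall>\<^sub>F n in sequentially. (\<Sum>k\<in>nat_box l K. \<bar>pmf (P n) k - q n k\<bar>) < \<delta>"
      using \<delta> by (rule order_tendstoD(2))
    with P_K have "\<forall>\<^sub>F n in sequentially. norm (d_TV l (P n) (independent_poisson_vector l (r n)) - 0) < \<epsilon>"
    proof eventually_elim
      case (elim n)
      have "0 \<le> d_TV l (P n) (independent_poisson_vector l (r n))"
        unfolding d_TV_def by (rule infsum_nonneg) simp
      moreover have "d_TV l (P n) (independent_poisson_vector l (r n)) < \<epsilon>"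
        using d_TV_le_finite[OF finite_nat_box, of l "P n" "independent_poisson_vector l (r n)" l K]
          elim q_K[rule_format, of n] \<delta> by (simp add: \<delta>_def q_def)
      ultimately show ?case
        by simp
    qed
    then show "\<exists>no. \<forall>n\<ge>no. norm (d_TV l (P n) (independent_poisson_vector l (r n)) - 0) < \<epsilon>"
      by (simp add: eventually_sequentially)
  qed
qed

section \<open>Graphs as symmetric relations\<close>

definition arcs :: "'a set set \<Rightarrow> ('a \<times> 'a) set" where
  "arcs E = {(u, v). u \<noteq> v \<and> {u, v} \<in> E}"

definition matching_of :: "'a set \<Rightarrow> ('a \<Rightarrow> 'a) \<Rightarrow> 'a graph" where
  "matching_of V \<sigma> = \<lparr>verts = V, edges = (\<lambda>v. {v, \<sigma> v}) ` V\<rparr>"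

lemma sym_arcs: "sym (arcs E)"
  by (auto simp: arcs_def sym_def insert_commute)

text \<open>Each edge has two orientations. This doubling is the source of the factors 2 in the
  counts of arcs below.\<close>

lemma card_arcs:
  assumes "finite E" and "\<And>e. e \<in> E \<Longrightarrow> card e = 2"
  shows "card (arcs E) = 2 * card E"
proof -
  let ?A = "\<lambda>e. {(u, v). u \<noteq> v \<and> {u, v} = e}"
  have A: "finite (?A e) \<and> card (?A e) = 2" if e: "e \<in> E" for e
  proof -
    obtain x y where "e = {x, y}" "x \<noteq> y"
      using assms(2)[OF e] by (auto simp: card_2_iff)
    then have "?A e = {(x, y), (y, x)}"
      by (auto simp: doubleton_eq_iff)
    then show ?thesis
      using \<open>x \<noteq> y\<close> by simp
  qed
  have "arcs E = (\<Union>e\<in>E. ?A e)"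
    by (auto simp: arcs_def)
  then have "card (arcs E) = card (\<Union>e\<in>E. ?A e)"
    by (rule arg_cong)
  also have "\<dots> = (\<Sum>e\<in>E. card (?A e))"
    using assms(1) A by (intro card_UN_disjoint) auto
  also have "\<dots> = 2 * card E"
    using A by simp
  finally show ?thesis .
qed

lemma card_arcs_Image_le:
  assumes "finite (edges G)"
  shows "card (arcs (edges G) `` {v}) \<le> degree G v"
  unfolding degree_def
proof (rule card_inj_on_le)
  show "inj_on (\<lambda>w. {v, w}) (arcs (edges G) `` {v})"
    by (auto simp: inj_on_def doubleton_eq_iff)
qed (use assms in \<open>auto simp: arcs_def\<close>)

lemma card_arcs_Image_le_max_degree:
  assumes G: "simple_graph G"
  shows "card (arcs (edges G) `` {v}) \<le> max_degree G"
proof (cases "v \<in> verts G")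
  case True
  have "finite (edges G)"
    using G by (auto simp: simple_graph_def intro: finite_subset[of _ "Pow (verts G)"])
  then have "card (arcs (edges G) `` {v}) \<le> degree G v"
    by (rule card_arcs_Image_le)
  also have "\<dots> \<le> max_degree G"
    unfolding max_degree_def using True G by (intro Max_ge) (auto simp: simple_graph_def)
  finally show ?thesis .
next
  case False
  then have "arcs (edges G) `` {v} = {}"
    using G by (auto simp: arcs_def simple_graph_def)
  then show ?thesis
    by simp
qed

section \<open>Switchings of perfect matchings\<close>

text \<open>The bound \<open>h\<close> concerns the union of all the graphs, because a switching
  that is to change a single count by one edge has to avoid every one of them elsewhere.\<close>

locale switching =
  fixes V :: "'a set" and N :: "('a \<times> 'a) set" and I :: "'i set"
    and D :: "'i \<Rightarrow> ('a \<times> 'a) set" and h :: nat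
  assumes finite_V: "finite V" and finite_I: "finite I"
    and N_sub: "N \<subseteq> V \<times> V" and D_sub: "i \<in> I \<Longrightarrow> D i \<subseteq> V \<times> V"
    and sym_N: "sym N" and sym_D: "i \<in> I \<Longrightarrow> sym (D i)"
    and irrefl_D: "i \<in> I \<Longrightarrow> (v, v) \<notin> D i"
    and D_N_disjoint: "i \<in> I \<Longrightarrow> D i \<inter> N = {}"
    and D_disjoint: "i \<in> I \<Longrightarrow> j \<in> I \<Longrightarrow> i \<noteq> j \<Longrightarrow> D i \<inter> D j = {}"
    and degree_H: "card ((N \<union> (\<Union>i\<in>I. D i)) `` {v}) \<le> h"
begin

definition H where "H = N \<union> (\<Union>i\<in>I. D i)"

text \<open>Being the identity outside V makes such a function determined by its values on V, so
  that there are finitely many and each matching has exactly one representative.\<close>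

definition involutions :: "('a \<Rightarrow> 'a) set" where
  "involutions = {\<sigma>. (\<forall>v. v \<notin> V \<longrightarrow> \<sigma> v = v) \<and> (\<forall>v\<in>V. \<sigma> v \<in> V \<and> \<sigma> v \<noteq> v \<and> \<sigma> (\<sigma> v) = v)}"

definition cnt :: "('a \<times> 'a) set \<Rightarrow> ('a \<Rightarrow> 'a) \<Rightarrow> nat" where
  "cnt R \<sigma> = card {v \<in> V. (v, \<sigma> v) \<in> R}"

definition \<Omega> where "\<Omega> = {\<sigma> \<in> involutions. cnt N \<sigma> = 0}"

text \<open>The event that the count vector equals k: \<open>cnt\<close> meets every matching edge
  at both ends, hence \<open>2 * k i\<close>.\<close>

definition level where "level k = {\<sigma> \<in> \<Omega>. \<forall>i\<in>I. cnt (D i) \<sigma> = 2 * k i}"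

text \<open>For b and c on different matching edges, the edges from b to \<open>\<sigma> b\<close>
  and from c to \<open>\<sigma> c\<close> give way to those from b to \<open>\<sigma> c\<close> and
  from c to \<open>\<sigma> b\<close>. Being a conjugation by a transposition, the operation
  preserves \<open>involutions\<close> and is its own inverse.\<close>

definition switch :: "'a \<Rightarrow> 'a \<Rightarrow> ('a \<Rightarrow> 'a) \<Rightarrow> 'a \<Rightarrow> 'a" where
  "switch b c \<sigma> = Transposition.transpose b c \<circ> \<sigma> \<circ> Transposition.transpose b c"

lemma switch_switch [simp]: "switch b c (switch b c \<sigma>) = \<sigma>"
  by (simp add: switch_def fun_eq_iff)

lemma involutionsD:
  assumes "\<sigma> \<in> involutions" "v \<in> V"
  shows "\<sigma> v \<in> V" "\<sigma> v \<noteq> v" "\<sigma> (\<sigma> v) = v"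
  using assms by (auto simp: involutions_def)

lemma finite_involutions: "finite involutions"
proof (rule inj_on_finite)
  show "inj_on (\<lambda>\<sigma>. restrict \<sigma> V) involutions"
  proof (rule inj_onI, rule ext)
    fix \<sigma> \<rho> v
    assume out: "\<sigma> \<in> involutions" "\<rho> \<in> involutions" and eq: "restrict \<sigma> V = restrict \<rho> V"
    show "\<sigma> v = \<rho> v"
      using out fun_cong[OF eq, of v] by (cases "v \<in> V") (simp_all add: involutions_def)
  qed
  show "(\<lambda>\<sigma>. restrict \<sigma> V) ` involutions \<subseteq> V \<rightarrow>\<^sub>E V"
    using involutionsD(1) by (intro image_subsetI restrict_PiE_iff[THEN iffD2] ballI)
  show "finite (V \<rightarrow>\<^sub>E V)"
    using finite_V by (simp add: finite_PiE)
qed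

lemma finite_\<Omega>: "finite \<Omega>"
  using finite_involutions by (simp add: \<Omega>_def)

lemma \<Omega>_involution: "\<sigma> \<in> \<Omega> \<Longrightarrow> \<sigma> \<in> involutions"
  by (simp add: \<Omega>_def)

lemma sym_H: "sym H"
  using sym_N sym_D by (fastforce simp: H_def sym_def)

lemma H_sub: "H \<subseteq> V \<times> V"
  using N_sub D_sub by (auto simp: H_def)

lemma card_H_Image: "card (H `` {v}) \<le> h"
  using degree_H by (simp add: H_def)

lemma finite_H_Image: "finite (H `` A)"
  by (rule finite_subset[OF _ finite_V]) (use H_sub in auto)

lemma D_sub_H: "i \<in> I \<Longrightarrow> D i \<subseteq> H"
  by (auto simp: H_def)

lemma N_sub_H: "N \<subseteq> H"
  by (auto simp: H_def)

lemma finite_D: "i \<in> I \<Longrightarrow> finite (D i)"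
  using finite_subset[OF D_sub] finite_V by simp

lemma card_H: "card H \<le> card V * h"
proof -
  have "H = Sigma V (\<lambda>v. H `` {v})"
    using H_sub by auto
  then have "card H = card (Sigma V (\<lambda>v. H `` {v}))"
    by (rule arg_cong)
  also have "\<dots> = (\<Sum>v\<in>V. card (H `` {v}))"
    using finite_V finite_H_Image by (intro card_SigmaI) auto
  also have "\<dots> \<le> card V * h"
    using sum_bounded_above[of V "\<lambda>v. card (H `` {v})" h] card_H_Image by simp
  finally show ?thesis .
qed

section \<open>The effect of one switching\<close>

lemma switch_apply:
  assumes "\<sigma> \<in> involutions" "b \<in> V" "c \<in> V" "c \<noteq> b" "\<sigma> b \<noteq> c"
  shows "distinct [b, c, \<sigma> b, \<sigma> c]"
    "switch b c \<sigma> b = \<sigma> c" "switch b c \<sigma> c = \<sigma> b"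
    "switch b c \<sigma> (\<sigma> b) = c" "switch b c \<sigma> (\<sigma> c) = b"
    "v \<notin> {b, c, \<sigma> b, \<sigma> c} \<Longrightarrow> switch b c \<sigma> v = \<sigma> v"
proof -
  have b: "\<sigma> b \<noteq> b" "\<sigma> (\<sigma> b) = b" and c: "\<sigma> c \<noteq> c" "\<sigma> (\<sigma> c) = c"
    using involutionsD[OF assms(1)] assms(2,3) by auto
  have ne: "\<sigma> c \<noteq> b" "\<sigma> b \<noteq> \<sigma> c"
    using b c assms(4,5) by metis+
  show "distinct [b, c, \<sigma> b, \<sigma> c]"
    using ne b(1) c(1) assms(4,5) by auto
  show "switch b c \<sigma> b = \<sigma> c" "switch b c \<sigma> c = \<sigma> b"
    "switch b c \<sigma> (\<sigma> b) = c" "switch b c \<sigma> (\<sigma> c) = b"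
    using ne b c assms(4,5) by (simp_all add: switch_def Transposition.transpose_def)
  show "switch b c \<sigma> v = \<sigma> v" if v: "v \<notin> {b, c, \<sigma> b, \<sigma> c}"
  proof -
    have "\<sigma> (\<sigma> v) = v"
      using assms(1) by (cases "v \<in> V") (simp_all add: involutions_def)
    then have "\<sigma> v \<noteq> b" "\<sigma> v \<noteq> c"
      using v by auto
    then show ?thesis
      using v by (simp add: switch_def Transposition.transpose_def)
  qed
qed

lemma switch_involution:
  assumes "\<sigma> \<in> involutions" "b \<in> V" "c \<in> V"
  shows "switch b c \<sigma> \<in> involutions"
proof -
  have "Transposition.transpose b c v \<in> V \<longleftrightarrow> v \<in> V" for v
    using assms by (auto simp: Transposition.transpose_def)
  then show ?thesis
    using assms(1) unfolding involutions_def switch_def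
    by (auto simp: transpose_eq_iff) (metis assms(2,3))+
qed

text \<open>Only four vertices change partners, and by symmetry of R each lost or gained edge counts
  at both of its ends. Losses and gains stand on opposite sides to avoid truncated
  subtraction.\<close>

lemma cnt_switch:
  assumes "\<sigma> \<in> involutions" "b \<in> V" "c \<in> V" "c \<noteq> b" "\<sigma> b \<noteq> c" and R: "sym R"
  shows "cnt R (switch b c \<sigma>) + 2 * of_bool ((b, \<sigma> b) \<in> R) + 2 * of_bool ((c, \<sigma> c) \<in> R) =
    cnt R \<sigma> + 2 * of_bool ((b, \<sigma> c) \<in> R) + 2 * of_bool ((c, \<sigma> b) \<in> R)"
proof -
  let ?F = "{b, c, \<sigma> b, \<sigma> c}"
  note d = involutionsD[OF assms(1)]
  have F: "?F \<subseteq> V"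
    using assms d by auto
  have cnt_sum: "cnt R \<rho> = (\<Sum>v\<in>V - ?F. of_bool ((v, \<rho> v) \<in> R)) + (\<Sum>v\<in>?F. of_bool ((v, \<rho> v) \<in> R))"
    for \<rho>
  proof -
    have "cnt R \<rho> = (\<Sum>v\<in>V. of_bool ((v, \<rho> v) \<in> R))"
      using finite_V by (simp add: cnt_def Int_def of_bool_def sum.If_cases)
    also have "\<dots> = (\<Sum>v\<in>V - ?F. of_bool ((v, \<rho> v) \<in> R)) + (\<Sum>v\<in>?F. of_bool ((v, \<rho> v) \<in> R))"
      using F finite_V by (rule sum.subset_diff)
    finally show ?thesis .
  qed
  have sw: "(v, w) \<in> R \<longleftrightarrow> (w, v) \<in> R" for v w
    using R by (meson symD)
  have sum_F: "sum f ?F = f b + f c + f (\<sigma> b) + f (\<sigma> c)" for f :: "'a \<Rightarrow> nat"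
    using switch_apply(1)[OF assms(1-5)] by simp
  have "(\<Sum>v\<in>V - ?F. of_bool ((v, switch b c \<sigma> v) \<in> R)) =
      (\<Sum>v\<in>V - ?F. of_bool ((v, \<sigma> v) \<in> R) :: nat)"
    using switch_apply(6)[OF assms(1-5)] by (intro sum.cong) auto
  moreover have "(\<Sum>v\<in>?F. of_bool ((v, \<sigma> v) \<in> R)) =
      2 * of_bool ((b, \<sigma> b) \<in> R) + 2 * (of_bool ((c, \<sigma> c) \<in> R) :: nat)"
    unfolding sum_F using assms(2,3) d sw by simp
  moreover have "(\<Sum>v\<in>?F. of_bool ((v, switch b c \<sigma> v) \<in> R)) =
      2 * of_bool ((b, \<sigma> c) \<in> R) + 2 * (of_bool ((c, \<sigma> b) \<in> R) :: nat)"
    unfolding sum_F using sw switch_apply(2-5)[OF assms(1-5)] by simp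
  ultimately show ?thesis
    unfolding cnt_sum by simp
qed

section \<open>Existence of matchings and first moments\<close>

lemma \<Omega>_avoids_N: "\<sigma> \<in> \<Omega> \<Longrightarrow> v \<in> V \<Longrightarrow> (v, \<sigma> v) \<notin> N"
  using finite_V by (auto simp: \<Omega>_def cnt_def)

lemma switch_\<Omega>:
  assumes "\<sigma> \<in> \<Omega>" "b \<in> V" "c \<in> V" "c \<noteq> b" "\<sigma> b \<noteq> c" "(b, \<sigma> c) \<notin> N" "(c, \<sigma> b) \<notin> N"
  shows "switch b c \<sigma> \<in> \<Omega>"
  using assms cnt_switch[OF \<Omega>_involution[OF assms(1)] assms(2-5) sym_N]
  by (auto simp: \<Omega>_def switch_involution)

text \<open>With \<open>d = \<sigma> b\<close> these are the x for which switching b with x would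
  create an edge of \<open>H\<close>. The first alternative places x in the image under \<sigma> of
  the neighbourhood of b, the second in the neighbourhood of d.\<close>

lemma card_bad_partners:
  assumes "\<sigma> \<in> involutions"
  shows "card {x \<in> V. (b, \<sigma> x) \<in> H \<or> (x, d) \<in> H} \<le> 2 * h"
proof -
  have sw: "(v, w) \<in> H \<longleftrightarrow> (w, v) \<in> H" for v w
    using sym_H by (meson symD)
  have "{x \<in> V. (b, \<sigma> x) \<in> H \<or> (x, d) \<in> H} \<subseteq> \<sigma> ` (H `` {b}) \<union> H `` {d}"
  proof
    fix x assume x: "x \<in> {x \<in> V. (b, \<sigma> x) \<in> H \<or> (x, d) \<in> H}"
    then have "x = \<sigma> (\<sigma> x)"
      using assms involutionsD(3) by force
    with x show "x \<in> \<sigma> ` (H `` {b}) \<union> H `` {d}"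
      using sw by blast
  qed
  then have "card {x \<in> V. (b, \<sigma> x) \<in> H \<or> (x, d) \<in> H} \<le> card (\<sigma> ` (H `` {b}) \<union> H `` {d})"
    by (intro card_mono) (auto simp: finite_H_Image)
  also have "\<dots> \<le> card (H `` {b}) + card (H `` {d})"
    by (rule order_trans[OF card_Un_le]) (simp add: card_image_le finite_H_Image)
  finally show ?thesis
    using card_H_Image[of b] card_H_Image[of d] by linarith
qed

text \<open>An involution using the least number of arcs of \<open>N\<close> uses none, as otherwise a switching
  would remove one.\<close>

lemma \<Omega>_nonempty:
  assumes "involutions \<noteq> {}" and "2 * h + 2 < card V"
  shows "\<Omega> \<noteq> {}"
proof -
  obtain \<sigma> where \<sigma>: "\<sigma> \<in> involutions" and min: "\<And>\<rho>. \<rho> \<in> involutions \<Longrightarrow> cnt N \<sigma> \<le> cnt N \<rho>"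
    using arg_min_if_finite(1)[OF finite_involutions assms(1)]
      arg_min_least[OF finite_involutions assms(1)] by blast
  have "cnt N \<sigma> = 0"
  proof (rule ccontr)
    assume "cnt N \<sigma> \<noteq> 0"
    then obtain b where b: "b \<in> V" "(b, \<sigma> b) \<in> N"
      by (auto simp: cnt_def card_eq_0_iff)
    let ?bad = "{x \<in> V. (b, \<sigma> x) \<in> H \<or> (x, \<sigma> b) \<in> H} \<union> {b, \<sigma> b}"
    have "card ?bad \<le> 2 * h + 2"
      using card_bad_partners[OF \<sigma>, of b "\<sigma> b"]
      by (intro order_trans[OF card_Un_le] add_mono) (auto intro: order_trans[OF card_insert_le_m1])
    then have "\<not> V \<subseteq> ?bad"
      using assms(2) finite_V card_mono[of ?bad V] by auto
    then obtain c where c: "c \<in> V" "c \<noteq> b" "\<sigma> b \<noteq> c" "(b, \<sigma> c) \<notin> N" "(c, \<sigma> b) \<notin> N"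
      using N_sub_H by auto
    have "cnt N (switch b c \<sigma>) < cnt N \<sigma>"
      using cnt_switch[OF \<sigma> b(1) c(1-3) sym_N] b(2) c(4,5) by simp
    then show False
      using min[OF switch_involution[OF \<sigma> b(1) c(1)]] by simp
  qed
  then show ?thesis
    using \<sigma> by (auto simp: \<Omega>_def)
qed

text \<open>Switching \<open>b j\<close> with all but a bounded number of vertices \<open>x\<close> stays in \<open>\<Omega>\<close>; recording the old
  partner of \<open>b j\<close> makes the map injective, as \<open>x\<close> is the new partner of the old partner.\<close>

lemma switching_bound:
  fixes Z :: "(('a \<Rightarrow> 'a) \<times> 'j) set"
  assumes fin: "finite Z" "finite Z'"
    and Z: "\<And>\<sigma> j. (\<sigma>, j) \<in> Z \<Longrightarrow> \<sigma> \<in> \<Omega> \<and> b j \<in> V \<and> finite (W \<sigma> j) \<and> card (W \<sigma> j) \<le> w"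
    and sw: "\<And>\<sigma> j x. (\<sigma>, j) \<in> Z \<Longrightarrow> x \<in> V \<Longrightarrow> x \<notin> W \<sigma> j \<Longrightarrow> x \<noteq> b j \<Longrightarrow> \<sigma> (b j) \<noteq> x \<Longrightarrow>
      switch (b j) x \<sigma> \<in> \<Omega> \<Longrightarrow> (switch (b j) x \<sigma>, j, \<sigma> (b j)) \<in> Z'"
  shows "card Z * (card V - (2 * h + 2 + w)) \<le> card Z'"
proof -
  \<comment> \<open>The admissible x. Excluded are at most 2 h vertices that would create an edge of
    \<open>H\<close>, the two ends of the edge at \<open>b j\<close>, and at most w vertices of
    \<open>W\<close>, with which an application protects other edges of the matching.\<close>
  define X where "X = (\<lambda>(\<sigma>, j). V - ({x \<in> V. (b j, \<sigma> x) \<in> H \<or> (x, \<sigma> (b j)) \<in> H} \<union> {b j, \<sigma> (b j)} \<union> W \<sigma> j))"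
  define f where "f = (\<lambda>((\<sigma>, j), x). (switch (b j) x \<sigma>, j, \<sigma> (b j)))"
  have X: "card V - (2 * h + 2 + w) \<le> card (X z)" if "z \<in> Z" for z
  proof -
    obtain \<sigma> j where z: "z = (\<sigma>, j)"
      by (cases z)
    let ?E = "{x \<in> V. (b j, \<sigma> x) \<in> H \<or> (x, \<sigma> (b j)) \<in> H}"
    have "card (?E \<union> {b j, \<sigma> (b j)} \<union> W \<sigma> j) \<le> card ?E + card {b j, \<sigma> (b j)} + card (W \<sigma> j)"
      by (meson add_mono_thms_linordered_semiring(3) card_Un_le order_trans)
    also have "\<dots> \<le> 2 * h + 2 + w"
      using Z that z by (intro add_mono card_bad_partners) (auto simp: \<Omega>_involution card_insert_if)
    finally have "card V - (2 * h + 2 + w) \<le> card V - card (?E \<union> {b j, \<sigma> (b j)} \<union> W \<sigma> j)"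
      by simp
    also have "\<dots> \<le> card (X z)"
      unfolding z X_def using Z that z finite_V by (simp add: diff_card_le_card_Diff)
    finally show ?thesis .
  qed
  have fX: "finite (X z)" for z
    using finite_V by (simp add: X_def split: prod.split)
  have XD: "x \<in> V" "x \<notin> W \<sigma> j" "x \<noteq> b j" "\<sigma> (b j) \<noteq> x" "(b j, \<sigma> x) \<notin> N" "(x, \<sigma> (b j)) \<notin> N"
    if "x \<in> X (\<sigma>, j)" for x \<sigma> j
    using that N_sub_H by (auto simp: X_def)
  have "card Z * (card V - (2 * h + 2 + w)) \<le> (\<Sum>z\<in>Z. card (X z))"
    using sum_bounded_below[of Z "card V - (2 * h + 2 + w)" "\<lambda>z. card (X z)"] X by simp
  also have "\<dots> = card (Sigma Z X)"
    using fin(1) fX by (simp add: card_SigmaI)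
  also have "\<dots> \<le> card Z'"
  proof (rule card_inj_on_le)
    show "inj_on f (Sigma Z X)"
    proof (rule inj_onI)
      fix p q assume pq: "p \<in> Sigma Z X" "q \<in> Sigma Z X" "f p = f q"
      obtain \<sigma> j x \<rho> i y where p: "p = ((\<sigma>, j), x)" and q: "q = ((\<rho>, i), y)"
        by (metis surj_pair)
      have 1: "(\<sigma>, j) \<in> Z" "x \<in> X (\<sigma>, j)" and 2: "(\<rho>, i) \<in> Z" "y \<in> X (\<rho>, i)"
        using pq p q by auto
      have eq: "switch (b j) x \<sigma> = switch (b j) y \<rho>" "i = j" "\<sigma> (b j) = \<rho> (b j)"
        using pq(3) p q by (auto simp: f_def)
      have "x = switch (b j) x \<sigma> (\<sigma> (b j))"
        using Z[OF 1(1)] XD[OF 1(2)] by (intro switch_apply(4)[symmetric]) (auto simp: \<Omega>_involution)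
      moreover have "y = switch (b i) y \<rho> (\<rho> (b i))"
        using Z[OF 2(1)] XD[OF 2(2)] by (intro switch_apply(4)[symmetric]) (auto simp: \<Omega>_involution)
      ultimately have "x = y"
        using eq by simp
      then have "\<sigma> = \<rho>"
        using eq(1) switch_switch by metis
      then show "p = q"
        using \<open>x = y\<close> eq p q by simp
    qed
    show "f ` Sigma Z X \<subseteq> Z'"
    proof (rule image_subsetI)
      fix p assume "p \<in> Sigma Z X"
      then obtain \<sigma> j x where "p = ((\<sigma>, j), x)" "(\<sigma>, j) \<in> Z" "x \<in> X (\<sigma>, j)"
        by auto
      then show "f p \<in> Z'"
        using Z[of \<sigma> j] XD[of x \<sigma> j] sw[of \<sigma> j x] switch_\<Omega>[of \<sigma> "b j" x] by (simp add: f_def)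
    qed
  qed (rule fin(2))
  finally show ?thesis .
qed

text \<open>Switching away the edge at a leaves as record only the arc
  \<open>(a, \<sigma> a)\<close> of \<open>D i\<close>. On average a matching therefore uses at most
  about \<open>card (D i) / card V\<close> arcs of \<open>D i\<close>, which is bounded.\<close>

lemma sum_cnt_le:
  assumes i: "i \<in> I"
  shows "(\<Sum>\<sigma>\<in>\<Omega>. cnt (D i) \<sigma>) * (card V - (2 * h + 2)) \<le> card \<Omega> * card (D i)"
proof -
  let ?Z = "Sigma \<Omega> (\<lambda>\<sigma>. {a \<in> V. (a, \<sigma> a) \<in> D i})"
  have "card ?Z * (card V - (2 * h + 2 + 0)) \<le> card (\<Omega> \<times> D i)"
  proof (rule switching_bound[where b = "\<lambda>a. a" and W = "\<lambda>_ _. {}"])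
    show "finite ?Z" "finite (\<Omega> \<times> D i)"
      using finite_\<Omega> finite_V finite_D[OF i] by auto
  qed auto
  moreover have "card ?Z = (\<Sum>\<sigma>\<in>\<Omega>. cnt (D i) \<sigma>)"
    using finite_\<Omega> finite_V by (simp add: cnt_def)
  ultimately show ?thesis
    by (simp add: card_cartesian_product)
qed

text \<open>Switching these pairs would create an edge \<open>\<sigma> a, \<sigma> b\<close> of \<open>H\<close>. A single matching
  may have linearly many of them, so they are only bounded on average.\<close>

definition near_pairs where
  "near_pairs i = {(\<sigma>, a, b). \<sigma> \<in> \<Omega> \<and> (a, b) \<in> D i \<and> (\<sigma> a, \<sigma> b) \<in> H \<and> \<sigma> a \<noteq> b}"

lemma finite_near_pairs: "i \<in> I \<Longrightarrow> finite (near_pairs i)"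
  using finite_subset[of "near_pairs i" "\<Omega> \<times> D i"] finite_\<Omega> finite_D by (auto simp: near_pairs_def)

text \<open>The edge at b is switched away while the edge at a stays, because \<open>W\<close>
  excludes a and \<open>\<sigma> a\<close>; these two vertices turn \<open>2 * h + 2\<close> into
  \<open>2 * h + 4\<close>. Afterwards the recorded old partner of b is one of at most h neighbours
  of the unchanged partner of a.\<close>

lemma card_near_pairs:
  assumes i: "i \<in> I"
  shows "card (near_pairs i) * (card V - (2 * h + 4)) \<le> card \<Omega> * (card (D i) * h)"
proof -
  let ?Z' = "Sigma \<Omega> (\<lambda>\<sigma>. Sigma (D i) (\<lambda>p. H `` {\<sigma> (fst p)}))"
  have fin: "finite (Sigma (D i) (\<lambda>p. H `` {\<sigma> (fst p)}))" for \<sigma>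
    using finite_D[OF i] finite_H_Image by auto
  have "card (near_pairs i) * (card V - (2 * h + 2 + 2)) \<le> card ?Z'"
  proof (rule switching_bound[where b = snd and W = "\<lambda>\<sigma> p. {fst p, \<sigma> (fst p)}"])
    show "finite ?Z'"
      using finite_\<Omega> fin by auto
    fix \<sigma> :: "'a \<Rightarrow> 'a" and j assume Z: "(\<sigma>, j) \<in> near_pairs i"
    obtain a b where j: "j = (a, b)"
      by (cases j)
    have *: "\<sigma> \<in> \<Omega>" "a \<in> V" "b \<in> V" "(a, b) \<in> D i" "(\<sigma> a, \<sigma> b) \<in> H" "\<sigma> a \<noteq> b" "a \<noteq> b"
      using Z j D_sub[OF i] irrefl_D[OF i] by (auto simp: near_pairs_def)
    show "\<sigma> \<in> \<Omega> \<and> snd j \<in> V \<and> finite {fst j, \<sigma> (fst j)} \<and> card {fst j, \<sigma> (fst j)} \<le> 2"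
      using * j by (auto simp: card_insert_if)
    fix x assume x: "x \<in> V" "x \<notin> {fst j, \<sigma> (fst j)}" "x \<noteq> snd j" "\<sigma> (snd j) \<noteq> x"
      and sw: "switch (snd j) x \<sigma> \<in> \<Omega>"
    have "a \<notin> {b, x, \<sigma> b, \<sigma> x}"
      using * x j \<Omega>_involution[OF *(1)] involutionsD(3) by fastforce
    then have "switch b x \<sigma> a = \<sigma> a"
      using * x j \<Omega>_involution by (intro switch_apply(6)) auto
    then show "(switch (snd j) x \<sigma>, j, \<sigma> (snd j)) \<in> ?Z'"
      using sw j * by simp
  qed (use finite_near_pairs[OF i] in auto)
  also have "card ?Z' = (\<Sum>\<sigma>\<in>\<Omega>. \<Sum>p\<in>D i. card (H `` {\<sigma> (fst p)}))"
    using finite_\<Omega> fin finite_D[OF i] finite_H_Image by (simp add: card_SigmaI)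
  also have "\<dots> \<le> (\<Sum>\<sigma>\<in>\<Omega>. \<Sum>p\<in>D i. h)"
    by (intro sum_mono card_H_Image)
  finally show ?thesis
    by (simp add: numeral_eq_Suc)
qed

section \<open>Double counting between neighbouring levels\<close>

lemma cnt_H_le:
  assumes "\<sigma> \<in> level k"
  shows "cnt H \<sigma> \<le> 2 * (\<Sum>i\<in>I. k i)"
proof -
  have "{v \<in> V. (v, \<sigma> v) \<in> H} \<subseteq> (\<Union>i\<in>I. {v \<in> V. (v, \<sigma> v) \<in> D i})"
    using \<Omega>_avoids_N[of \<sigma>] assms by (auto simp: level_def H_def)
  then have "cnt H \<sigma> \<le> card (\<Union>i\<in>I. {v \<in> V. (v, \<sigma> v) \<in> D i})"
    unfolding cnt_def using finite_V finite_I by (intro card_mono) auto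
  also have "\<dots> \<le> (\<Sum>i\<in>I. cnt (D i) \<sigma>)"
    unfolding cnt_def using finite_I by (rule card_UN_le)
  also have "\<dots> = (\<Sum>i\<in>I. 2 * k i)"
    using assms by (intro sum.cong) (auto simp: level_def)
  finally show ?thesis
    by (simp add: sum_distrib_left)
qed

lemma finite_level: "finite (level k)"
  using finite_\<Omega> by (simp add: level_def)

lemma level_involution: "\<sigma> \<in> level k \<Longrightarrow> \<sigma> \<in> involutions"
  by (simp add: level_def \<Omega>_def)

text \<open>Of the two old and two new edges only the one from b to \<open>\<sigma> c\<close> lies
  in \<open>H\<close>, and by disjointness it affects the count of \<open>D m\<close> alone. The
  equivalence serves both directions of the bijection in \<open>card_switchings\<close>.\<close>

lemma switch_level_iff:
  assumes \<sigma>: "\<sigma> \<in> involutions" "b \<in> V" "c \<in> V" "c \<noteq> b" "\<sigma> b \<noteq> c" and m: "m \<in> I"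
    and R: "(b, \<sigma> c) \<in> D m" "(b, \<sigma> b) \<notin> H" "(c, \<sigma> c) \<notin> H" "(c, \<sigma> b) \<notin> H"
  shows "switch b c \<sigma> \<in> level (k(m := k m + 1)) \<longleftrightarrow> \<sigma> \<in> level k"
proof -
  have N: "cnt N (switch b c \<sigma>) = cnt N \<sigma>"
  proof -
    have "(b, \<sigma> c) \<notin> N" "(b, \<sigma> b) \<notin> N" "(c, \<sigma> c) \<notin> N" "(c, \<sigma> b) \<notin> N"
      using R N_sub_H D_N_disjoint[OF m] by auto
    then show ?thesis
      using cnt_switch[OF \<sigma> sym_N] by simp
  qed
  have D: "cnt (D i) (switch b c \<sigma>) = cnt (D i) \<sigma> + (if i = m then 2 else 0)" if "i \<in> I" for i
  proof -
    have "(b, \<sigma> c) \<in> D i \<longleftrightarrow> i = m" "(b, \<sigma> b) \<notin> D i" "(c, \<sigma> c) \<notin> D i" "(c, \<sigma> b) \<notin> D i"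
      using R D_sub_H[OF that] D_disjoint[OF that m] by auto
    then show ?thesis
      using cnt_switch[OF \<sigma> sym_D[OF that]] by simp
  qed
  show ?thesis
    using \<sigma> by (auto simp: level_def \<Omega>_def N D switch_involution)
qed

text \<open>The left side removes an edge of \<open>D m\<close> from the matching, the right side
  inserts one. The ends \<open>(a, b)\<close> of that edge are kept as record, and c can be read off
  as the new partner of a, so the two switchings invert each other.\<close>

lemma card_switchings:
  assumes m: "m \<in> I"
  shows "card (Sigma (level (k(m := k m + 1))) (\<lambda>\<sigma>. Sigma {a \<in> V. (a, \<sigma> a) \<in> D m}
      (\<lambda>a. V - ({a, \<sigma> a} \<union> {c \<in> V. (a, c) \<in> H \<or> (\<sigma> a, \<sigma> c) \<in> H \<or> (c, \<sigma> c) \<in> H}))))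
    = card {(\<sigma>, a, b). \<sigma> \<in> level k \<and> (a, b) \<in> D m \<and> (a, \<sigma> a) \<notin> H \<and> (b, \<sigma> b) \<notin> H \<and> (\<sigma> a, \<sigma> b) \<notin> H}"
    (is "card ?P = card ?Q")
proof -
  have sw: "(v, w) \<in> H \<longleftrightarrow> (w, v) \<in> H" "(v, w) \<in> D m \<longleftrightarrow> (w, v) \<in> D m" for v w
    using sym_H sym_D[OF m] by (meson symD)+
  define f where "f = (\<lambda>(\<sigma>, a, c). (switch (\<sigma> a) c \<sigma>, a, \<sigma> a))"
  define g where "g = (\<lambda>(\<sigma>, a, b). (switch b (\<sigma> a) \<sigma>, a, \<sigma> a))"
  have P: "f p \<in> ?Q \<and> g (f p) = p" if "p \<in> ?P" for p
  proof -
    obtain \<sigma> a c where p: "p = (\<sigma>, a, c)"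
      by (metis surj_pair)
    have *: "\<sigma> \<in> level (k(m := k m + 1))" "a \<in> V" "(a, \<sigma> a) \<in> D m" "c \<in> V" "c \<noteq> a" "c \<noteq> \<sigma> a"
      "(a, c) \<notin> H" "(\<sigma> a, \<sigma> c) \<notin> H" "(c, \<sigma> c) \<notin> H"
      using that p by auto
    have flip: "(\<sigma> a, a) \<in> D m" "(c, a) \<notin> H"
      using * sw by blast+
    note inv = level_involution[OF *(1)]
    note d = involutionsD[OF inv *(2)]
    have ba: "\<sigma> (\<sigma> a) \<noteq> c"
      using d *(5) by simp
    note s = switch_apply(2-5)[OF inv d(1) *(4) *(6) ba]
    \<comment> \<open>\<open>switch_level_iff\<close> speaks of creating an edge of
      \<open>D m\<close>, so it is applied to the reverse switching.\<close>
    have "switch (\<sigma> a) c (switch (\<sigma> a) c \<sigma>) \<in> level (k(m := k m + 1)) \<longleftrightarrow> switch (\<sigma> a) c \<sigma> \<in> level k"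
    proof (rule switch_level_iff)
      show "switch (\<sigma> a) c \<sigma> \<in> involutions" "\<sigma> a \<in> V" "c \<in> V" "c \<noteq> \<sigma> a" "m \<in> I"
        using * d inv m switch_involution by auto
      show "switch (\<sigma> a) c \<sigma> (\<sigma> a) \<noteq> c"
        using s(1) involutionsD(2)[OF inv *(4)] by simp
    qed (use s d flip * in \<open>simp_all\<close>)
    then have "switch (\<sigma> a) c \<sigma> \<in> level k"
      using *(1) by simp
    moreover have "switch (\<sigma> a) c \<sigma> a = c"
      using s(3) d(3) by simp
    ultimately show ?thesis
      using s d * p by (simp add: f_def g_def)
  qed
  have Q: "g q \<in> ?P \<and> f (g q) = q" if "q \<in> ?Q" for q
  proof -
    obtain \<sigma> a b where q: "q = (\<sigma>, a, b)"
      by (metis surj_pair)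
    have *: "\<sigma> \<in> level k" "a \<in> V" "b \<in> V" "(a, b) \<in> D m" "a \<noteq> b"
      "(a, \<sigma> a) \<notin> H" "(b, \<sigma> b) \<notin> H" "(\<sigma> a, \<sigma> b) \<notin> H" "(a, b) \<in> H"
      using that q D_sub[OF m] irrefl_D[OF m] D_sub_H[OF m] by auto
    have flip: "(b, a) \<in> D m" "(\<sigma> a, a) \<notin> H" "(\<sigma> b, \<sigma> a) \<notin> H"
      using * sw by blast+
    note inv = level_involution[OF *(1)]
    note d = involutionsD[OF inv *(2)]
    have ne: "\<sigma> a \<noteq> b" "\<sigma> b \<noteq> \<sigma> a"
      using * involutionsD(3)[OF inv *(2)] involutionsD(3)[OF inv *(3)] by metis+
    note s = switch_apply(2-5)[OF inv *(3) d(1) ne]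
    have "switch b (\<sigma> a) \<sigma> \<in> level (k(m := k m + 1)) \<longleftrightarrow> \<sigma> \<in> level k"
      by (rule switch_level_iff) (use d * flip ne inv m in simp_all)
    then have "switch b (\<sigma> a) \<sigma> \<in> level (k(m := k m + 1))"
      using *(1) by simp
    moreover have "switch b (\<sigma> a) \<sigma> a = b"
      using s(4) d(3) by simp
    ultimately show ?thesis
      using s d * flip ne q by (simp add: f_def g_def)
  qed
  have "bij_betw f ?P ?Q"
    by (rule bij_betw_byWitness[where f' = g]; intro ballI image_subsetI) (simp_all only: P Q)
  then show ?thesis
    by (rule bij_betw_same_card)
qed

text \<open>Both bounds estimate the set \<open>Q\<close> of possible insertions: from the upper
  level, where nearly every vertex is an admissible c, and from the lower level, where nearly every
  arc of \<open>D m\<close> can be inserted.\<close>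

lemma card_level_Suc_le:
  assumes m: "m \<in> I"
  shows "card (level (k(m := k m + 1))) * (2 * (k m + 1)) * (card V - (2 * h + 2 * (\<Sum>i\<in>I. k i) + 4))
    \<le> card (level k) * card (D m)"
    and "card (level k) * card (D m) \<le> card (level (k(m := k m + 1))) * (2 * (k m + 1)) * card V
      + card (level k) * (4 * (\<Sum>i\<in>I. k i) * h) + card (near_pairs m)"
proof -
  define S where "S = (\<Sum>i\<in>I. k i)"
  define k' where "k' = k(m := k m + 1)"
  define A where "A = (\<lambda>\<sigma>. {a \<in> V. (a, \<sigma> a) \<in> D m})"
  define X where "X = (\<lambda>\<sigma> a. V - ({a, \<sigma> a} \<union> {c \<in> V. (a, c) \<in> H \<or> (\<sigma> a, \<sigma> c) \<in> H \<or> (c, \<sigma> c) \<in> H}))"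
  define Q where "Q = {(\<sigma>, a, b). \<sigma> \<in> level k \<and> (a, b) \<in> D m \<and> (a, \<sigma> a) \<notin> H \<and> (b, \<sigma> b) \<notin> H \<and> (\<sigma> a, \<sigma> b) \<notin> H}"
  have swH: "(v, w) \<in> H \<longleftrightarrow> (w, v) \<in> H" for v w
    using sym_H by (meson symD)
  have finA: "finite (A \<sigma>)" and finX: "finite (X \<sigma> a)" for \<sigma> a
    using finite_V by (auto simp: A_def X_def)
  have cardA: "card (A \<sigma>) = 2 * (k m + 1)" if "\<sigma> \<in> level k'" for \<sigma>
    using that m by (auto simp: A_def level_def k'_def cnt_def)
  have "(\<Sum>i\<in>I. k' i) = S + 1"
    using sum.remove[OF finite_I m, of k'] sum.remove[OF finite_I m, of k] by (simp add: S_def k'_def)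
  then have H_k': "cnt H \<sigma> \<le> 2 * S + 2" if "\<sigma> \<in> level k'" for \<sigma>
    using cnt_H_le[OF that] by simp
  \<comment> \<open>The loss consists of a and its partner, at most 2 h vertices that would create
    an edge of \<open>H\<close>, and at most 2 S + 2 ends of matching edges in \<open>H\<close>, the
    total at level \<open>k'\<close> being S + 1.\<close>
  have X: "card V - (2 * h + 2 * S + 4) \<le> card (X \<sigma> a)" if \<sigma>: "\<sigma> \<in> level k'" for \<sigma> a
  proof -
    let ?E = "{c \<in> V. (\<sigma> a, \<sigma> c) \<in> H \<or> (c, a) \<in> H}" and ?F = "{c \<in> V. (c, \<sigma> c) \<in> H}"
    have "card ({a, \<sigma> a} \<union> ?E \<union> ?F) \<le> card {a, \<sigma> a} + card ?E + card ?F"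
      by (meson add_mono_thms_linordered_semiring(3) card_Un_le order_trans)
    also have "\<dots> \<le> 2 + 2 * h + (2 * S + 2)"
      using H_k'[OF \<sigma>] card_bad_partners[OF level_involution[OF \<sigma>]]
      by (intro add_mono) (auto simp: cnt_def card_insert_if)
    finally have "card V - (2 * h + 2 * S + 4) \<le> card V - card ({a, \<sigma> a} \<union> ?E \<union> ?F)"
      by simp
    also have "\<dots> \<le> card (V - ({a, \<sigma> a} \<union> ?E \<union> ?F))"
      using finite_V by (intro diff_card_le_card_Diff) auto
    also have "V - ({a, \<sigma> a} \<union> ?E \<union> ?F) = X \<sigma> a"
      using swH[of a] by (auto simp: X_def)
    finally show ?thesis .
  qed
  have card_Q: "card Q = (\<Sum>\<sigma>\<in>level k'. \<Sum>a\<in>A \<sigma>. card (X \<sigma> a))"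
    using card_switchings[OF m, of k] finite_level finA finX
    by (simp add: Q_def k'_def A_def X_def)
  have Q_sub: "Q \<subseteq> level k \<times> D m"
    by (auto simp: Q_def)
  have fin: "finite (level k \<times> D m)"
    using finite_level finite_D[OF m] by simp
  have "card (level k') * (2 * (k m + 1)) * (card V - (2 * h + 2 * S + 4)) =
      (\<Sum>\<sigma>\<in>level k'. \<Sum>a\<in>A \<sigma>. card V - (2 * h + 2 * S + 4))"
    by (simp add: cardA add_mult_distrib add_mult_distrib2 mult.assoc mult.left_commute)
  also have "\<dots> \<le> card Q"
    unfolding card_Q by (intro sum_mono X)
  also have "\<dots> \<le> card (level k) * card (D m)"
    using card_mono[OF fin Q_sub] by (simp add: card_cartesian_product)
  finally show "card (level (k(m := k m + 1))) * (2 * (k m + 1)) * (card V - (2 * h + 2 * (\<Sum>i\<in>I. k i) + 4))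
    \<le> card (level k) * card (D m)"
    by (simp add: k'_def S_def)
  have "card Q \<le> (\<Sum>\<sigma>\<in>level k'. \<Sum>a\<in>A \<sigma>. card V)"
    unfolding card_Q by (intro sum_mono card_mono finite_V) (auto simp: X_def)
  also have "\<dots> = card (level k') * (2 * (k m + 1)) * card V"
    by (simp add: cardA add_mult_distrib add_mult_distrib2 mult.assoc mult.left_commute)
  finally have Q_le: "card Q \<le> card (level k') * (2 * (k m + 1)) * card V" .
  \<comment> \<open>Triples in which a (in \<open>Q1\<close>) or b (in \<open>Q2\<close>) is matched
    along an edge of \<open>H\<close>: at most 2 S such ends, and at most h choices for the other
    end of the arc. The case \<open>\<sigma> a = b\<close> falls under \<open>Q1\<close>, so the
    triples left outside \<open>Q\<close> are near pairs.\<close>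
  define Q1 where "Q1 = Sigma (level k) (\<lambda>\<sigma>. Sigma {a \<in> V. (a, \<sigma> a) \<in> H} (\<lambda>a. H `` {a}))"
  define Q2 where "Q2 = (\<lambda>(\<sigma>, b, a). (\<sigma>, a, b)) ` Q1"
  have finQ1: "finite Q1"
    unfolding Q1_def using finite_level finite_V finite_H_Image by auto
  have "card Q1 = (\<Sum>\<sigma>\<in>level k. \<Sum>a | a \<in> V \<and> (a, \<sigma> a) \<in> H. card (H `` {a}))"
    unfolding Q1_def using finite_level finite_V finite_H_Image by simp
  also have "\<dots> \<le> (\<Sum>\<sigma>\<in>level k. \<Sum>a | a \<in> V \<and> (a, \<sigma> a) \<in> H. h)"
    by (intro sum_mono card_H_Image)
  also have "\<dots> = (\<Sum>\<sigma>\<in>level k. cnt H \<sigma> * h)"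
    by (simp add: cnt_def)
  also have "\<dots> \<le> (\<Sum>\<sigma>\<in>level k. 2 * S * h)"
    using cnt_H_le by (intro sum_mono mult_right_mono) (auto simp: S_def)
  finally have Q1_le: "card Q1 \<le> card (level k) * (2 * S * h)"
    by simp
  have Q2_le: "card Q2 \<le> card Q1"
    unfolding Q2_def using finQ1 by (rule card_image_le)
  have cover: "level k \<times> D m \<subseteq> Q \<union> Q1 \<union> Q2 \<union> near_pairs m"
  proof
    fix p assume "p \<in> level k \<times> D m"
    then obtain \<sigma> a b where p: "p = (\<sigma>, a, b)" and \<sigma>: "\<sigma> \<in> level k" and ab: "(a, b) \<in> D m"
      by auto
    have V: "a \<in> V" "b \<in> V" and H: "(a, b) \<in> H" "(b, a) \<in> H"
      using ab D_sub[OF m] D_sub_H[OF m] swH by auto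
    consider "(a, \<sigma> a) \<in> H" | "(b, \<sigma> b) \<in> H" | "(a, \<sigma> a) \<notin> H" "(b, \<sigma> b) \<notin> H" "(\<sigma> a, \<sigma> b) \<in> H"
      | "(a, \<sigma> a) \<notin> H" "(b, \<sigma> b) \<notin> H" "(\<sigma> a, \<sigma> b) \<notin> H"
      by blast
    then show "p \<in> Q \<union> Q1 \<union> Q2 \<union> near_pairs m"
    proof cases
      case 1
      then show ?thesis
        using \<sigma> V H p by (simp add: Q1_def)
    next
      case 2
      then have "(\<sigma>, b, a) \<in> Q1"
        using \<sigma> V H by (simp add: Q1_def)
      then have "p \<in> Q2"
        unfolding Q2_def p by (rule rev_image_eqI) simp
      then show ?thesis
        by simp
    next
      case 3
      then have "\<sigma> a \<noteq> b"
        using H by auto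
      then show ?thesis
        using 3 \<sigma> ab p by (simp add: near_pairs_def level_def)
    next
      case 4
      then show ?thesis
        using \<sigma> ab p by (simp add: Q_def)
    qed
  qed
  have "card (level k \<times> D m) \<le> card (Q \<union> Q1 \<union> Q2 \<union> near_pairs m)"
    using cover finite_subset[OF Q_sub fin] finQ1 finite_near_pairs[OF m]
    by (intro card_mono) (auto simp: Q2_def)
  also have "\<dots> \<le> card Q + card Q1 + card Q2 + card (near_pairs m)"
    by (meson add_mono_thms_linordered_semiring(3) card_Un_le order_trans)
  also have "\<dots> \<le> card (level k') * (2 * (k m + 1)) * card V + card (level k) * (4 * S * h) + card (near_pairs m)"
    using Q_le Q1_le Q2_le by (simp add: algebra_simps)
  finally show "card (level k) * card (D m) \<le> card (level (k(m := k m + 1))) * (2 * (k m + 1)) * card V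
      + card (level k) * (4 * (\<Sum>i\<in>I. k i) * h) + card (near_pairs m)"
    by (simp add: k'_def S_def card_cartesian_product)
qed

section \<open>Error and tail bounds\<close>

lemma card_D_le:
  assumes m: "m \<in> I"
  shows "card (D m) \<le> card V * h"
  using card_mono[OF _ D_sub_H[OF m]] card_H finite_subset[OF H_sub] finite_V by fastforce

text \<open>The lower bound on \<open>card V\<close> makes \<open>card V - (2 * h + 4)\<close> at
  least half of \<open>card V\<close>, which then cancels against
  \<open>card (D m) \<le> card V * h\<close>.\<close>

lemma card_near_pairs_le:
  assumes m: "m \<in> I" and V: "4 * h + 8 \<le> card V"
  shows "card (near_pairs m) \<le> 2 * h\<^sup>2 * card \<Omega>"
proof -
  have "card V \<le> 2 * (card V - (2 * h + 4))"
    using V by linarith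
  then have "card (near_pairs m) * card V \<le> card (near_pairs m) * (2 * (card V - (2 * h + 4)))"
    by (rule mult_left_mono) simp
  also have "\<dots> = 2 * (card (near_pairs m) * (card V - (2 * h + 4)))"
    by (simp only: mult.left_commute)
  also have "\<dots> \<le> 2 * (card \<Omega> * (card (D m) * h))"
    using card_near_pairs[OF m] by (rule mult_left_mono) simp
  also have "\<dots> \<le> 2 * (card \<Omega> * ((card V * h) * h))"
    using card_D_le[OF m] by (intro mult_left_mono mult_right_mono) auto
  also have "\<dots> = (2 * h\<^sup>2 * card \<Omega>) * card V"
    by (simp add: power2_eq_square)
  finally show ?thesis
    using V by (simp del: mult_Suc_right)
qed

text \<open>The error is compared with \<open>card \<Omega>\<close> because near pairs are bounded
  over all of \<Omega> and not level by level. Dividing by \<open>2 * card V * card \<Omega>\<close>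
  will leave an error of order \<open>1 / card V\<close>.\<close>

lemma level_ratio:
  assumes m: "m \<in> I" and V: "4 * h + 8 \<le> card V"
  shows "\<bar>2 * real (k m + 1) * real (card (level (k(m := k m + 1)))) * real (card V)
      - real (card (level k)) * real (card (D m))\<bar>
    \<le> real (2 * (k m + 1) * (2 * h + 2 * (\<Sum>i\<in>I. k i) + 4) + 4 * (\<Sum>i\<in>I. k i) * h + 2 * h\<^sup>2) * real (card \<Omega>)"
proof -
  define S where "S = (\<Sum>i\<in>I. k i)"
  define k' where "k' = k(m := k m + 1)"
  define q where "q = card (level k')"
  define p where "p = card (level k)"
  define r where "r = 2 * (k m + 1)"
  have le: "p \<le> card \<Omega>" "q \<le> card \<Omega>"
    using finite_\<Omega> by (auto simp: p_def q_def level_def intro!: card_mono)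
  have "card V \<le> (card V - (2 * h + 2 * S + 4)) + (2 * h + 2 * S + 4)"
    by linarith
  then have "q * r * card V \<le> q * r * ((card V - (2 * h + 2 * S + 4)) + (2 * h + 2 * S + 4))"
    by (rule mult_le_mono2)
  also have "\<dots> = q * r * (card V - (2 * h + 2 * S + 4)) + q * r * (2 * h + 2 * S + 4)"
    by (rule add_mult_distrib2)
  also have "\<dots> \<le> p * card (D m) + q * r * (2 * h + 2 * S + 4)"
    using card_level_Suc_le(1)[OF m, of k] unfolding p_def q_def r_def S_def k'_def
    by (rule add_right_mono)
  also have "\<dots> \<le> p * card (D m) + card \<Omega> * r * (2 * h + 2 * S + 4)"
    using le by (intro add_left_mono mult_right_mono) auto
  finally have 1: "q * r * card V \<le> p * card (D m) + r * (2 * h + 2 * S + 4) * card \<Omega>"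
    by (simp only: mult.assoc mult.commute[of "card \<Omega>"])
  have "p * card (D m) \<le> q * r * card V + p * (4 * S * h) + card (near_pairs m)"
    using card_level_Suc_le(2)[OF m, of k] unfolding p_def q_def r_def S_def k'_def .
  also have "\<dots> \<le> q * r * card V + card \<Omega> * (4 * S * h) + 2 * h\<^sup>2 * card \<Omega>"
    using le card_near_pairs_le[OF m V] by (intro add_mono mult_right_mono) auto
  finally have 2: "p * card (D m) \<le> q * r * card V + (4 * S * h + 2 * h\<^sup>2) * card \<Omega>"
    by (simp only: add_mult_distrib add.assoc mult.commute[of "card \<Omega>"])
  have "real (q * r * card V) \<le> real (p * card (D m) + r * (2 * h + 2 * S + 4) * card \<Omega>)"
    "real (p * card (D m)) \<le> real (q * r * card V + (4 * S * h + 2 * h\<^sup>2) * card \<Omega>)"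
    using 1 2 by (simp_all only: of_nat_le_iff)
  moreover have "0 \<le> real (r * (2 * h + 2 * S + 4) * card \<Omega>)" "0 \<le> real ((4 * S * h + 2 * h\<^sup>2) * card \<Omega>)"
    by simp_all
  ultimately have "\<bar>real (q * r * card V) - real (p * card (D m))\<bar>
      \<le> real (r * (2 * h + 2 * S + 4) * card \<Omega>) + real ((4 * S * h + 2 * h\<^sup>2) * card \<Omega>)"
    unfolding of_nat_add by linarith
  also have "\<dots> = real (r * (2 * h + 2 * S + 4) + 4 * S * h + 2 * h\<^sup>2) * real (card \<Omega>)"
    unfolding of_nat_mult[symmetric] of_nat_add[symmetric] by (simp only: add_mult_distrib add.assoc)
  finally have bound: "\<bar>real (q * r * card V) - real (p * card (D m))\<bar>
      \<le> real (r * (2 * h + 2 * S + 4) + 4 * S * h + 2 * h\<^sup>2) * real (card \<Omega>)" .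
  have "2 * real (k m + 1) * real q * real (card V) = real (q * r * card V)"
    "real p * real (card (D m)) = real (p * card (D m))"
    by (simp_all add: r_def algebra_simps)
  then have "\<bar>2 * real (k m + 1) * real q * real (card V) - real p * real (card (D m))\<bar>
      \<le> real (r * (2 * h + 2 * S + 4) + 4 * S * h + 2 * h\<^sup>2) * real (card \<Omega>)"
    using bound by (simp only:)
  then show ?thesis
    unfolding p_def q_def r_def S_def k'_def .
qed

text \<open>Markov's inequality for each i, the mean of \<open>cnt (D i)\<close> being at most 2 h,
  followed by a union bound.\<close>

lemma card_tail_le:
  assumes V: "4 * h + 8 \<le> card V"
  shows "card {\<sigma> \<in> \<Omega>. \<exists>i\<in>I. 2 * K < cnt (D i) \<sigma>} * K \<le> card I * h * card \<Omega>"
proof -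
  let ?T = "\<lambda>i. {\<sigma> \<in> \<Omega>. 2 * K < cnt (D i) \<sigma>}"
  have T: "card (?T i) * K \<le> h * card \<Omega>" if i: "i \<in> I" for i
  proof -
    define s where "s = (\<Sum>\<sigma>\<in>\<Omega>. cnt (D i) \<sigma>)"
    have "card V \<le> (card V - (2 * h + 2)) * 2"
      using V by linarith
    then have "s * card V \<le> s * ((card V - (2 * h + 2)) * 2)"
      by (rule mult_le_mono2)
    also have "\<dots> = s * (card V - (2 * h + 2)) * 2"
      by (simp only: mult.assoc)
    also have "\<dots> \<le> card \<Omega> * card (D i) * 2"
      using sum_cnt_le[OF i] unfolding s_def by (rule mult_le_mono1)
    also have "\<dots> \<le> card \<Omega> * (card V * h) * 2"
      using card_D_le[OF i] by (intro mult_le_mono1 mult_le_mono2)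
    also have "\<dots> = (card \<Omega> * h * 2) * card V"
      by simp
    finally have s: "s \<le> card \<Omega> * h * 2"
      using V by simp
    have "card (?T i) * (2 * K) = (\<Sum>\<sigma>\<in>?T i. 2 * K)"
      by simp
    also have "\<dots> \<le> (\<Sum>\<sigma>\<in>?T i. cnt (D i) \<sigma>)"
      by (intro sum_mono) auto
    also have "\<dots> \<le> s"
      unfolding s_def using finite_\<Omega> by (intro sum_mono2) auto
    also note s
    finally show ?thesis
      by (simp add: ac_simps)
  qed
  have "{\<sigma> \<in> \<Omega>. \<exists>i\<in>I. 2 * K < cnt (D i) \<sigma>} = (\<Union>i\<in>I. ?T i)"
    by auto
  then have "card {\<sigma> \<in> \<Omega>. \<exists>i\<in>I. 2 * K < cnt (D i) \<sigma>} \<le> (\<Sum>i\<in>I. card (?T i))"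
    using card_UN_le[OF finite_I, of ?T] by simp
  then have "card {\<sigma> \<in> \<Omega>. \<exists>i\<in>I. 2 * K < cnt (D i) \<sigma>} * K \<le> (\<Sum>i\<in>I. card (?T i)) * K"
    by (rule mult_le_mono1)
  also have "\<dots> \<le> (\<Sum>i\<in>I. h * card \<Omega>)"
    unfolding sum_distrib_right by (intro sum_mono T)
  finally show ?thesis
    by simp
qed

subsection \<open>Perfect matchings as involutions\<close>

lemma \<Omega>_arcs_iff:
  assumes N: "N = arcs E"
  shows "\<sigma> \<in> \<Omega> \<longleftrightarrow> \<sigma> \<in> involutions \<and> (\<forall>v\<in>V. {v, \<sigma> v} \<notin> E)"
proof -
  have "(v, \<sigma> v) \<in> N \<longleftrightarrow> {v, \<sigma> v} \<in> E" if "\<sigma> \<in> involutions" "v \<in> V" for v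
    using involutionsD(2)[OF that] by (simp add: N arcs_def not_sym)
  then show ?thesis
    using finite_V by (auto simp: \<Omega>_def cnt_def)
qed

lemma matching_edge_iff:
  assumes \<sigma>: "\<sigma> \<in> involutions" and u: "u \<in> V"
  shows "{u, w} \<in> edges (matching_of V \<sigma>) \<longleftrightarrow> w = \<sigma> u"
  using u involutionsD(3)[OF \<sigma>] by (auto simp: matching_of_def doubleton_eq_iff)

lemma matching_of_perfect:
  assumes N: "N = arcs E" and \<sigma>: "\<sigma> \<in> \<Omega>"
  shows "perfect_matching (matching_of V \<sigma>) \<lparr>verts = V, edges = {e. e \<subseteq> V \<and> card e = 2} - E\<rparr>"
proof -
  note inv = \<Omega>_involution[OF \<sigma>]
  note d = involutionsD[OF inv]
  have "degree (matching_of V \<sigma>) v = 1" if v: "v \<in> V" for v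
  proof -
    have "{e \<in> edges (matching_of V \<sigma>). v \<in> e} = {{v, \<sigma> v}}"
      using v d by (auto simp: matching_of_def)
    then show ?thesis
      by (simp add: degree_def)
  qed
  moreover have "{v, \<sigma> v} \<subseteq> V \<and> card {v, \<sigma> v} = 2 \<and> {v, \<sigma> v} \<notin> E" if "v \<in> V" for v
    using that d(1,2)[OF that] \<sigma> \<Omega>_arcs_iff[OF N] by (auto simp: card_insert_if)
  ultimately show ?thesis
    using finite_V by (auto simp: perfect_matching_def subgraph_def simple_graph_def matching_of_def)
qed

lemma inj_on_matching_of: "inj_on (matching_of V) \<Omega>"
proof (rule inj_onI, rule ext)
  fix \<sigma> \<rho> v assume "\<sigma> \<in> \<Omega>" "\<rho> \<in> \<Omega>" and eq: "matching_of V \<sigma> = matching_of V \<rho>"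
  then have inv: "\<sigma> \<in> involutions" "\<rho> \<in> involutions"
    by (simp_all add: \<Omega>_involution)
  show "\<sigma> v = \<rho> v"
  proof (cases "v \<in> V")
    case True
    then show ?thesis
      using matching_edge_iff[OF inv(1) True, of "\<sigma> v"] matching_edge_iff[OF inv(2) True, of "\<sigma> v"] eq by simp
  next
    case False
    then show ?thesis
      using inv by (simp add: involutions_def)
  qed
qed

text \<open>Degree 1 makes the other end of the edge at v a function of v; looking at the same edge
  from its other end shows that this function is an involution.\<close>

lemma perfect_matching_is_matching_of:
  assumes N: "N = arcs E" and M: "perfect_matching M \<lparr>verts = V, edges = {e. e \<subseteq> V \<and> card e = 2} - E\<rparr>"
  shows "M \<in> matching_of V ` \<Omega>"
proof -
  have verts: "verts M = V" and edges: "\<And>e. e \<in> edges M \<Longrightarrow> e \<subseteq> V \<and> card e = 2 \<and> e \<notin> E"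
    and deg: "\<And>v. v \<in> V \<Longrightarrow> degree M v = 1"
    using M by (auto simp: perfect_matching_def subgraph_def)
  have "\<forall>v\<in>V. \<exists>w. {e \<in> edges M. v \<in> e} = {{v, w}} \<and> w \<noteq> v"
  proof
    fix v assume "v \<in> V"
    then obtain e where e: "{e \<in> edges M. v \<in> e} = {e}"
      using deg card_1_singletonE unfolding degree_def by metis
    then have "e \<in> edges M" "v \<in> e"
      by auto
    then obtain w where "e = {v, w}" "w \<noteq> v"
      using edges[of e] by (auto simp: card_2_iff)
    with e show "\<exists>w. {e \<in> edges M. v \<in> e} = {{v, w}} \<and> w \<noteq> v"
      by auto
  qed
  then obtain s where s: "\<And>v. v \<in> V \<Longrightarrow> {e \<in> edges M. v \<in> e} = {{v, s v}}" "\<And>v. v \<in> V \<Longrightarrow> s v \<noteq> v"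
    by metis
  define \<sigma> where "\<sigma> v = (if v \<in> V then s v else v)" for v
  have s_edge: "{v, s v} \<in> edges M" if "v \<in> V" for v
    using s(1)[OF that] by auto
  have sV: "s v \<in> V" if "v \<in> V" for v
    using edges[OF s_edge[OF that]] by auto
  have ss: "s (s v) = v" if "v \<in> V" for v
  proof -
    have "{v, s v} \<in> {e \<in> edges M. s v \<in> e}"
      using s_edge[OF that] by simp
    then show ?thesis
      unfolding s(1)[OF sV[OF that]] by (auto simp: doubleton_eq_iff)
  qed
  have inv: "\<sigma> \<in> involutions"
    using sV ss s(2) by (auto simp: involutions_def \<sigma>_def)
  have "{v, \<sigma> v} \<notin> E" if "v \<in> V" for v
    using edges[OF s_edge[OF that]] that by (simp add: \<sigma>_def)
  then have "\<sigma> \<in> \<Omega>"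
    using inv \<Omega>_arcs_iff[OF N] by blast
  moreover have "edges M = (\<lambda>v. {v, \<sigma> v}) ` V"
  proof
    show "edges M \<subseteq> (\<lambda>v. {v, \<sigma> v}) ` V"
    proof
      fix e assume e: "e \<in> edges M"
      then obtain v where v: "v \<in> e" "v \<in> V"
        using edges[OF e] by (metis card.empty ex_in_conv subsetD zero_neq_numeral)
      then have "e \<in> {e \<in> edges M. v \<in> e}"
        using e by simp
      then have "e = {v, \<sigma> v}"
        unfolding s(1)[OF v(2)] using v by (simp add: \<sigma>_def)
      then show "e \<in> (\<lambda>v. {v, \<sigma> v}) ` V"
        using v by blast
    qed
    show "(\<lambda>v. {v, \<sigma> v}) ` V \<subseteq> edges M"
      using s_edge by (auto simp: \<sigma>_def)
  qed
  then have "M = matching_of V \<sigma>"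
    using verts by (simp add: matching_of_def)
  ultimately show ?thesis
    by blast
qed

lemma bij_betw_matching_of:
  assumes "N = arcs E"
  shows "bij_betw (matching_of V) \<Omega>
    {M. perfect_matching M \<lparr>verts = V, edges = {e. e \<subseteq> V \<and> card e = 2} - E\<rparr>}"
  unfolding bij_betw_def
  using inj_on_matching_of matching_of_perfect[OF assms] perfect_matching_is_matching_of[OF assms] by blast

lemma cnt_arcs:
  assumes \<sigma>: "\<sigma> \<in> involutions"
  shows "cnt (arcs E) \<sigma> = 2 * card (edges (matching_of V \<sigma>) \<inter> E)"
proof -
  note d = involutionsD[OF \<sigma>]
  have "cnt (arcs E) \<sigma> = card ((\<lambda>v. (v, \<sigma> v)) ` {v \<in> V. (v, \<sigma> v) \<in> arcs E})"
    unfolding cnt_def by (rule card_image[symmetric]) (auto simp: inj_on_def)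
  also have "(\<lambda>v. (v, \<sigma> v)) ` {v \<in> V. (v, \<sigma> v) \<in> arcs E} = arcs (edges (matching_of V \<sigma>) \<inter> E)"
  proof (intro equalityI subrelI)
    fix u w assume "(u, w) \<in> (\<lambda>v. (v, \<sigma> v)) ` {v \<in> V. (v, \<sigma> v) \<in> arcs E}"
    then show "(u, w) \<in> arcs (edges (matching_of V \<sigma>) \<inter> E)"
      using matching_edge_iff[OF \<sigma>] by (auto simp: arcs_def)
  next
    fix u w assume uw: "(u, w) \<in> arcs (edges (matching_of V \<sigma>) \<inter> E)"
    then have e: "{u, w} \<in> edges (matching_of V \<sigma>)"
      by (simp add: arcs_def)
    then have "u \<in> V"
      using d(1) by (auto simp: matching_of_def doubleton_eq_iff)
    then show "(u, w) \<in> (\<lambda>v. (v, \<sigma> v)) ` {v \<in> V. (v, \<sigma> v) \<in> arcs E}"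
      using e uw matching_edge_iff[OF \<sigma>] by (auto simp: arcs_def)
  qed
  also have "card \<dots> = 2 * card (edges (matching_of V \<sigma>) \<inter> E)"
    using finite_V d(2)[symmetric] by (intro card_arcs) (auto simp: matching_of_def card_insert_if)
  finally show ?thesis .
qed

end

section \<open>The law of the edge counts\<close>

text \<open>The factor \<open>l + 1\<close> counts N and the l graphs \<open>D m\<close>, each
  giving a vertex at most C neighbours.\<close>

lemma switching_arcs:
  assumes N: "subgraph N (complete_graph k)"
    and D: "\<And>m. m \<in> {1..l} \<Longrightarrow> subgraph (D m) (delete_edges (complete_graph k) N)"
    and disjoint: "\<And>i j. i \<in> {1..l} \<Longrightarrow> j \<in> {1..l} \<Longrightarrow> i \<noteq> j \<Longrightarrow> edge_disjoint (D i) (D j)"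
    and deg_N: "max_degree N \<le> C" and deg_D: "\<And>m. m \<in> {1..l} \<Longrightarrow> max_degree (D m) \<le> C"
  shows "switching {1..k} (arcs (edges N)) {1..l} (\<lambda>m. arcs (edges (D m))) ((l + 1) * C)"
proof
  have N_edges: "e \<subseteq> {1..k}" if "e \<in> edges N" for e
    using N that by (auto simp: subgraph_def complete_graph_def)
  have D_edges: "e \<subseteq> {1..k} \<and> e \<notin> edges N" if "m \<in> {1..l}" "e \<in> edges (D m)" for m e
    using D[OF that(1)] that(2) by (auto simp: subgraph_def complete_graph_def delete_edges_def)
  show "arcs (edges N) \<subseteq> {1..k} \<times> {1..k}"
    using N_edges by (fastforce simp: arcs_def)
  show "arcs (edges (D m)) \<subseteq> {1..k} \<times> {1..k}" if "m \<in> {1..l}" for m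
    using D_edges[OF that] by (fastforce simp: arcs_def)
  show "arcs (edges (D m)) \<inter> arcs (edges N) = {}" if "m \<in> {1..l}" for m
    using D_edges[OF that] by (auto simp: arcs_def)
  show "arcs (edges (D i)) \<inter> arcs (edges (D j)) = {}" if "i \<in> {1..l}" "j \<in> {1..l}" "i \<noteq> j" for i j
    using disjoint[OF that] by (auto simp: arcs_def edge_disjoint_def)
  show "card ((arcs (edges N) \<union> (\<Union>i\<in>{1..l}. arcs (edges (D i)))) `` {v}) \<le> (l + 1) * C" for v
  proof -
    have "(arcs (edges N) \<union> (\<Union>i\<in>{1..l}. arcs (edges (D i)))) `` {v} =
        arcs (edges N) `` {v} \<union> (\<Union>i\<in>{1..l}. arcs (edges (D i)) `` {v})"
      by auto
    then have "card ((arcs (edges N) \<union> (\<Union>i\<in>{1..l}. arcs (edges (D i)))) `` {v})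
        \<le> card (arcs (edges N) `` {v}) + card (\<Union>i\<in>{1..l}. arcs (edges (D i)) `` {v})"
      using card_Un_le by metis
    also have "\<dots> \<le> card (arcs (edges N) `` {v}) + (\<Sum>i\<in>{1..l}. card (arcs (edges (D i)) `` {v}))"
      by (intro add_left_mono card_UN_le) simp
    also have "\<dots> \<le> C + (\<Sum>i\<in>{1..l}. C)"
    proof (intro add_mono sum_mono)
      show "card (arcs (edges N) `` {v}) \<le> C"
        using N deg_N by (auto simp: subgraph_def intro: order_trans[OF card_arcs_Image_le_max_degree])
      show "card (arcs (edges (D i)) `` {v}) \<le> C" if "i \<in> {1..l}" for i
        using D[OF that] deg_D[OF that]
        by (auto simp: subgraph_def intro: order_trans[OF card_arcs_Image_le_max_degree])
    qed
    finally show ?thesis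
      by simp
  qed
qed (simp_all add: sym_arcs, simp add: arcs_def)

text \<open>Nonemptiness of \<Omega> gives \<open>pmf_of_set\<close> its meaning, so that
  probabilities become quotients of cardinalities.\<close>

locale switching_graphs =
  switching V "arcs E" "{1..l}" "\<lambda>m. arcs (edges (G m))" h
  for V :: "'a set" and E and l and G :: "nat \<Rightarrow> 'a graph" and h +
  assumes \<Omega>_ne: "\<Omega> \<noteq> {}"
begin

definition law where
  "law = map_pmf (edge_count_vector l G)
    (random_perfect_matching \<lparr>verts = V, edges = {e. e \<subseteq> V \<and> card e = 2} - E\<rparr>)"

lemma prob_law:
  "measure_pmf.prob law A = card {\<sigma> \<in> \<Omega>. edge_count_vector l G (matching_of V \<sigma>) \<in> A} / card \<Omega>"
proof -
  have "random_perfect_matching \<lparr>verts = V, edges = {e. e \<subseteq> V \<and> card e = 2} - E\<rparr> =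
      map_pmf (matching_of V) (pmf_of_set \<Omega>)"
    unfolding random_perfect_matching_def
    by (rule map_pmf_of_set_bij_betw[OF bij_betw_matching_of[OF refl] \<Omega>_ne finite_\<Omega>, symmetric])
  then have "law = map_pmf (\<lambda>\<sigma>. edge_count_vector l G (matching_of V \<sigma>)) (pmf_of_set \<Omega>)"
    by (simp add: law_def map_pmf_comp)
  then show ?thesis
    using \<Omega>_ne finite_\<Omega> by (simp add: measure_pmf_of_set vimage_def Int_def)
qed

lemma edge_count_vector_eq:
  assumes "\<sigma> \<in> \<Omega>" "m \<in> {1..l}"
  shows "cnt (arcs (edges (G m))) \<sigma> = 2 * edge_count_vector l G (matching_of V \<sigma>) m"
  using assms by (simp add: edge_count_vector_def graph_inter_def cnt_arcs \<Omega>_involution)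

lemma edge_count_vector_extensional: "edge_count_vector l G M \<in> nat_vectors l"
  by (simp add: edge_count_vector_def nat_vectors_def)

lemma pmf_law:
  assumes k: "k \<in> nat_vectors l"
  shows "pmf law k = card (level k) / card \<Omega>"
proof -
  have "edge_count_vector l G (matching_of V \<sigma>) = k \<longleftrightarrow>
      (\<forall>m\<in>{1..l}. cnt (arcs (edges (G m))) \<sigma> = 2 * k m)" if "\<sigma> \<in> \<Omega>" for \<sigma>
  proof -
    have "edge_count_vector l G (matching_of V \<sigma>) = k \<longleftrightarrow>
        (\<forall>m\<in>{1..l}. edge_count_vector l G (matching_of V \<sigma>) m = k m)"
      using PiE_ext[OF edge_count_vector_extensional[unfolded nat_vectors_def] k[unfolded nat_vectors_def]]
      by blast
    then show ?thesis
      using edge_count_vector_eq[OF that] by simp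
  qed
  then have "{\<sigma> \<in> \<Omega>. edge_count_vector l G (matching_of V \<sigma>) \<in> {k}} = level k"
    unfolding level_def by blast
  then show ?thesis
    using prob_law[of "{k}"] by (simp add: measure_pmf_single)
qed

text \<open>Outside the box some coordinate exceeds K, which \<open>card_tail_le\<close> bounds
  independently of the number of vertices; this is the tightness of the edge counts.\<close>

lemma law_box_ge:
  assumes V: "4 * h + 8 \<le> card V" and K: "0 < K"
  shows "1 - l * h / K \<le> (\<Sum>k\<in>nat_box l K. pmf law k)"
proof -
  let ?T = "{\<sigma> \<in> \<Omega>. \<exists>i\<in>{1..l}. 2 * K < cnt (arcs (edges (G i))) \<sigma>}"
  let ?B = "{\<sigma> \<in> \<Omega>. edge_count_vector l G (matching_of V \<sigma>) \<in> nat_box l K}"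
  have \<Omega>: "0 < card \<Omega>"
    using \<Omega>_ne finite_\<Omega> by (simp add: card_gt_0_iff)
  have "\<Omega> \<subseteq> ?B \<union> ?T"
  proof
    fix \<sigma> assume \<sigma>: "\<sigma> \<in> \<Omega>"
    show "\<sigma> \<in> ?B \<union> ?T"
    proof (cases "\<exists>i\<in>{1..l}. 2 * K < cnt (arcs (edges (G i))) \<sigma>")
      case True
      then show ?thesis
        using \<sigma> by blast
    next
      case False
      have "edge_count_vector l G (matching_of V \<sigma>) i \<le> K" if i: "i \<in> {1..l}" for i
      proof -
        have "\<not> 2 * K < cnt (arcs (edges (G i))) \<sigma>"
          using False i by blast
        then show ?thesis
          using edge_count_vector_eq[OF \<sigma> i] by simp
      qed
      then have "edge_count_vector l G (matching_of V \<sigma>) \<in> nat_box l K"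
        using edge_count_vector_extensional[of "matching_of V \<sigma>"]
        unfolding nat_box_def nat_vectors_def PiE_iff by blast
      then show ?thesis
        using \<sigma> by blast
    qed
  qed
  then have "card \<Omega> \<le> card (?B \<union> ?T)"
    using finite_\<Omega> by (intro card_mono) auto
  also have "\<dots> \<le> card ?B + card ?T"
    by (rule card_Un_le)
  finally have "real (card \<Omega>) \<le> real (card ?B) + real (card ?T)"
    unfolding of_nat_add[symmetric] of_nat_le_iff .
  moreover have "real (card ?T) * K \<le> l * h * card \<Omega>"
    using card_tail_le[OF V, of K] unfolding of_nat_mult[symmetric] of_nat_le_iff by simp
  then have "real (card ?T) \<le> l * h / K * card \<Omega>"
    using K by (simp add: field_simps)
  ultimately have "(1 - l * h / K) * card \<Omega> \<le> card ?B"
    by (simp add: algebra_simps)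
  then have "1 - l * h / K \<le> card ?B / card \<Omega>"
    using \<Omega> by (simp add: pos_le_divide_eq)
  also have "\<dots> = measure_pmf.prob law (nat_box l K)"
    by (simp add: prob_law)
  also have "\<dots> = (\<Sum>k\<in>nat_box l K. pmf law k)"
    by (simp add: measure_measure_pmf_finite)
  finally show ?thesis .
qed

text \<open>This is \<open>level_ratio\<close> after normalisation. With 2 n vertices and two arcs
  per edge, the coefficient of \<open>pmf law k\<close> is the number of edges of \<open>G m\<close>
  divided by 2 n.\<close>

lemma law_ratio:
  assumes V: "4 * h + 8 \<le> card V" and k: "k \<in> nat_vectors l" and m: "m \<in> {1..l}"
  shows "\<bar>real (k m + 1) * pmf law (k(m := k m + 1)) - card (arcs (edges (G m))) / (2 * card V) * pmf law k\<bar>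
    \<le> real (2 * (k m + 1) * (2 * h + 2 * (\<Sum>i\<in>{1..l}. k i) + 4) + 4 * (\<Sum>i\<in>{1..l}. k i) * h + 2 * h\<^sup>2)
      / (2 * card V)"
    (is "\<bar>?d\<bar> \<le> real ?c / _")
proof -
  have \<Omega>: "0 < real (card \<Omega>)"
    using \<Omega>_ne finite_\<Omega> by (simp add: card_gt_0_iff)
  have V0: "0 < real (card V)"
    using V by simp
  have k': "k(m := k m + 1) \<in> nat_vectors l"
    using k m by (auto simp: nat_vectors_def PiE_iff extensional_def)
  let ?x = "2 * real (k m + 1) * real (card (level (k(m := k m + 1)))) * real (card V)
      - real (card (level k)) * real (card (arcs (edges (G m))))"
  have "?d = ?x / (2 * card V * card \<Omega>)"
    unfolding pmf_law[OF k] pmf_law[OF k'] using V0 \<Omega> by (simp add: field_simps del: of_nat_add)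
  then have "\<bar>?d\<bar> = \<bar>?x\<bar> / (2 * card V * card \<Omega>)"
    by (simp add: abs_divide)
  also have "\<dots> \<le> (real ?c * real (card \<Omega>)) / (2 * card V * card \<Omega>)"
    using level_ratio[OF m V, of k] by (rule divide_right_mono) simp
  also have "\<dots> = real ?c / (2 * card V)"
    using \<Omega> by simp
  finally show ?thesis .
qed

end

section \<open>Conclusion\<close>

lemma involutions_nonempty:
  fixes n :: nat
  assumes "switching {1..2 * n} N I D h"
  shows "switching.involutions {1..2 * n} \<noteq> {}"
proof -
  interpret switching "{1..2 * n}" N I D h
    by (rule assms)
  \<comment> \<open>The matching of 2 i - 1 with 2 i. It may use arcs of N;
    \<open>\<Omega>_nonempty\<close> then supplies a matching that avoids them.\<close>
  define \<sigma> where "\<sigma> v = (if v \<in> {1..2 * n} then if odd v then v + 1 else v - 1 else v)" for v :: nat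
  have "\<sigma> v \<in> {1..2 * n} \<and> \<sigma> v \<noteq> v \<and> \<sigma> (\<sigma> v) = v" if v: "v \<in> {1..2 * n}" for v
  proof (cases "odd v")
    case True
    then have "v \<noteq> 2 * n"
      by auto
    then have "v + 1 \<in> {1..2 * n}"
      using v by auto
    then show ?thesis
      using True v by (simp add: \<sigma>_def)
  next
    case False
    then have "v \<noteq> 1"
      by auto
    then have "v - 1 \<in> {1..2 * n}" "odd (v - 1)"
      using v False by auto
    then show ?thesis
      using False v by (simp add: \<sigma>_def)
  qed
  then have "\<sigma> \<in> involutions"
    unfolding involutions_def by (simp add: \<sigma>_def)
  then show ?thesis
    by blast
qed

theorem theorem1p2:
  fixes l C :: nat
    and N :: "nat \<Rightarrow> nat graph"
    and D :: "nat \<Rightarrow> nat \<Rightarrow> nat graph"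
  assumes "l \<ge> 1"
    and "\<And>n. n \<ge> 1 \<Longrightarrow> subgraph (N n) (complete_graph (2 * n))"
    and "\<And>n m. n \<ge> 1 \<Longrightarrow> m \<in> {1..l} \<Longrightarrow>
           subgraph (D n m) (delete_edges (complete_graph (2 * n)) (N n))"
    and "\<And>n i j. n \<ge> 1 \<Longrightarrow> i \<in> {1..l} \<Longrightarrow> j \<in> {1..l} \<Longrightarrow> i \<noteq> j \<Longrightarrow>
           edge_disjoint (D n i) (D n j)"
    and "\<And>n. n \<ge> 1 \<Longrightarrow> max_degree (N n) \<le> C"
    and "\<And>n m. n \<ge> 1 \<Longrightarrow> m \<in> {1..l} \<Longrightarrow> max_degree (D n m) \<le> C"
  shows "(\<lambda>n. d_TV l
            (map_pmf (edge_count_vector l (D n))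
              (random_perfect_matching (delete_edges (complete_graph (2 * n)) (N n))))
            (independent_poisson_vector l
              (\<lambda>m. real (card (edges (D n m))) / (2 * real n))))
         \<longlonglongrightarrow> 0"
proof (rule d_TV_poisson_limit)
  define h where "h = (l + 1) * C"
  let ?V = "\<lambda>n. {1..2 * n}"
  let ?P = "\<lambda>n. map_pmf (edge_count_vector l (D n))
    (random_perfect_matching (delete_edges (complete_graph (2 * n)) (N n)))"
  have sw: "switching (?V n) (arcs (edges (N n))) {1..l} (\<lambda>m. arcs (edges (D n m))) h" if "n \<ge> 1" for n
    unfolding h_def using assms(2-6)[OF that] by (intro switching_arcs) auto
  have arcs_D: "card (arcs (edges (D n m))) = 2 * card (edges (D n m))" if "n \<ge> 1" "m \<in> {1..l}" for n m
  proof (rule card_arcs)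
    have "edges (D n m) \<subseteq> Pow (?V n)"
      using assms(3)[OF that] by (auto simp: subgraph_def delete_edges_def complete_graph_def)
    then show "finite (edges (D n m))"
      by (rule finite_subset) simp
    show "card e = 2" if "e \<in> edges (D n m)" for e
      using assms(3)[OF \<open>n \<ge> 1\<close> \<open>m \<in> {1..l}\<close>] that by (auto simp: subgraph_def simple_graph_def)
  qed
  \<comment> \<open>The bound is required for every n. At n = 0 the graphs are unconstrained, but
    division by zero makes the rate 0.\<close>
  show "0 \<le> real (card (edges (D n m))) / (2 * real n) \<and> real (card (edges (D n m))) / (2 * real n) \<le> h"
    if m: "m \<in> {1..l}" for n m
  proof (cases "n = 0")
    case False
    then have n: "n \<ge> 1"
      by simp
    interpret switching "?V n" "arcs (edges (N n))" "{1..l}" "\<lambda>m. arcs (edges (D n m))" h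
      by (rule sw[OF n])
    have "2 * card (edges (D n m)) \<le> 2 * n * h"
      using card_D_le[OF m] arcs_D[OF n m] by simp
    then have "real (card (edges (D n m))) \<le> real (2 * n * h)"
      by (simp only: of_nat_le_iff)
    then show ?thesis
      using n by (simp add: field_simps)
  qed simp
  \<comment> \<open>The threshold makes the number 2 n of vertices at least
    \<open>4 * h + 8\<close>, which also suffices for \<open>\<Omega>_nonempty\<close>.\<close>
  have graphs: "switching_graphs (?V n) (edges (N n)) l (D n) h"
    and law: "switching_graphs.law (?V n) (edges (N n)) l (D n) = ?P n"
    and V: "4 * h + 8 \<le> card (?V n)" if n: "n \<ge> 2 * h + 4" for n
  proof -
    have n1: "n \<ge> 1"
      using n by simp
    interpret switching "?V n" "arcs (edges (N n))" "{1..l}" "\<lambda>m. arcs (edges (D n m))" h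
      by (rule sw[OF n1])
    show "4 * h + 8 \<le> card (?V n)"
      using n by simp
    show "switching_graphs (?V n) (edges (N n)) l (D n) h"
      using \<Omega>_nonempty[OF involutions_nonempty[OF sw[OF n1]]] n by unfold_locales simp
    then show "switching_graphs.law (?V n) (edges (N n)) l (D n) = ?P n"
      by (simp add: switching_graphs.law_def delete_edges_def complete_graph_def)
  qed
  show "(\<lambda>n. real (k m + 1) * pmf (?P n) (k(m := k m + 1))
      - real (card (edges (D n m))) / (2 * real n) * pmf (?P n) k) \<longlonglongrightarrow> 0"
    if k: "k \<in> nat_vectors l" and m: "m \<in> {1..l}" for k m
  proof (rule Lim_null_comparison)
    \<comment> \<open>The numerator in \<open>law_ratio\<close>; the division by 4 below comes from
      \<open>2 * card (?V n) = 4 * n\<close>.\<close>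
    define c where "c = 2 * (k m + 1) * (2 * h + 2 * (\<Sum>i\<in>{1..l}. k i) + 4)
      + 4 * (\<Sum>i\<in>{1..l}. k i) * h + 2 * h\<^sup>2"
    show "\<forall>\<^sub>F n in sequentially. norm (real (k m + 1) * pmf (?P n) (k(m := k m + 1))
      - real (card (edges (D n m))) / (2 * real n) * pmf (?P n) k) \<le> real c / 4 * (1 / real n)"
    proof (rule eventually_sequentiallyI)
      fix n assume n: "n \<ge> 2 * h + 4"
      interpret switching_graphs "?V n" "edges (N n)" l "D n" h
        by (rule graphs[OF n])
      have "card (arcs (edges (D n m))) / (2 * card (?V n)) = real (card (edges (D n m))) / (2 * real n)"
        using n m arcs_D[of n m] by simp
      then show "norm (real (k m + 1) * pmf (?P n) (k(m := k m + 1))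
          - real (card (edges (D n m))) / (2 * real n) * pmf (?P n) k) \<le> real c / 4 * (1 / real n)"
        using law_ratio[OF V[OF n] k m] unfolding law[OF n] c_def[symmetric] by simp
    qed
    show "(\<lambda>n. real c / 4 * (1 / real n)) \<longlonglongrightarrow> 0"
      by (intro tendsto_mult_right_zero lim_1_over_n)
  qed
  show "\<forall>\<^sub>F K in sequentially. \<forall>\<^sub>F n in sequentially. 1 - \<epsilon> \<le> (\<Sum>k\<in>nat_box l K. pmf (?P n) k)"
    if \<epsilon>: "0 < \<epsilon>" for \<epsilon>
  proof -
    have "(\<lambda>K. real (l * h) * (1 / real K)) \<longlonglongrightarrow> 0"
      by (intro tendsto_mult_right_zero lim_1_over_n)
    then have "\<forall>\<^sub>F K in sequentially. real (l * h) * (1 / real K) < \<epsilon>"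
      using \<epsilon> by (rule order_tendstoD(2))
    then show ?thesis
      using eventually_gt_at_top[of 0]
    proof eventually_elim
      case (elim K)
      show ?case
      proof (rule eventually_sequentiallyI)
        fix n assume n: "n \<ge> 2 * h + 4"
        show "1 - \<epsilon> \<le> (\<Sum>k\<in>nat_box l K. pmf (?P n) k)"
          using switching_graphs.law_box_ge[OF graphs[OF n] V[OF n] elim(2)] elim(1)
          unfolding law[OF n] by simp
      qed
    qed
  qed
qed

end
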